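(* There exist sub-space-times $(M,D,g,T)$ for which the time separation topology $\tau_{\mathrm{T^S}}$ differs from the Alexandrov topology $\mathscr{A}$.
   Context: A sub-space-time is a quadruple $(M,D,g,T)$ where $M$ is a connected smooth manifold, $D$ is a smooth bracket-generating distribution on $M$ of rank $k$ with $2\le k<\dim M$, $g$ is a smoothly varying non-degenerate symmetric bilinear form on the fibres $D_p$ of index $1$, and $T$ is a globally defined smooth horizontal vector field with $g(T,T)<0$. A horizontal curve is an absolutely continuous curve with $\dot\gamma\in D$ a.e. and $\dot\gamma$ locally square integrable w.r.t. an auxiliary Riemannian metric; it is timelike future directed (t.f.d.) if a.e. $g(\dot\gamma,\dot\gamma)<0$ and $g(T,\dot\gamma)<0$, nonspacelike future directed if a.e. $g(\dot\gamma,\dot\gamma)\le 0$, $\dot\gamma\ne0$, $g(T,\dot\gamma)<0$. $p\ll q$ means there is a horizontal t.f.d. curve from $p$ to $q$; $I^+(p)=\{q:p\ll q\}$, $I^-(p)=\{q:q\ll p\}$; $\mathscr{A}$ is generated by the subbasis $\{I^\pm(p)\}$. The time separation function is $\mathrm{T^S}(p,q)=\sup\{\int_0^1\sqrt{-g(\dot\gamma,\dot\gamma)}\,dt\}$ over horizontal nonspacelike future directed curves $\gamma\colon[0,1]\to M$ from $p$ to $q$ (and $0$ if there are none). Outer balls: $O^+(p,\epsilon)=\{q:\mathrm{T^S}(p,q)>\epsilon\}$, $O^-(p,\epsilon)=\{q:\mathrm{T^S}(q,p)>\epsilon\}$. The time separation topology $\tau_{\mathrm{T^S}}$ is generated by the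 subbasis $\{O^\pm(p,\epsilon):p\in M,\epsilon>0\}$. *)

theory Defs
  imports "HOL-Analysis.Analysis"
begin

text \<open>A real function is smooth (C-infinity) on the open set S if it belongs to a family F
  of continuous functions on S that is closed under taking partial derivatives in all
  basis directions (all iterated partial derivatives exist and are continuous).\<close>
definition smooth_on :: "'a::euclidean_space set \<Rightarrow> ('a \<Rightarrow> real) \<Rightarrow> bool" where
  "smooth_on S f \<longleftrightarrow>
     (\<exists>F. f \<in> F \<and>
        (\<forall>h\<in>F. continuous_on S h \<and>
           (\<forall>i\<in>Basis. \<exists>h'\<in>F. \<forall>x\<in>S.
              ((\<lambda>t. h (x + t *\<^sub>R i)) has_real_derivative h' x) (at 0))))"

definition smooth_field :: "'a::euclidean_space set \<Rightarrow> ('a \<Rightarrow> 'a) \<Rightarrow> bool" where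
  "smooth_field S X \<longleftrightarrow> (\<forall>b\<in>Basis. smooth_on S (\<lambda>q. X q \<bullet> b))"

definition lie_bracket :: "('a::euclidean_space \<Rightarrow> 'a) \<Rightarrow> ('a \<Rightarrow> 'a) \<Rightarrow> 'a \<Rightarrow> 'a" where
  "lie_bracket X Y = (\<lambda>p. vector_derivative (\<lambda>t. Y (p + t *\<^sub>R X p)) (at 0)
                         - vector_derivative (\<lambda>t. X (p + t *\<^sub>R Y p)) (at 0))"

definition horizontal_field :: "('a::euclidean_space \<Rightarrow> 'a set) \<Rightarrow> 'a set \<Rightarrow> ('a \<Rightarrow> 'a) \<Rightarrow> bool" where
  "horizontal_field D U X \<longleftrightarrow> smooth_field U X \<and> (\<forall>q\<in>U. X q \<in> D q)"

definition smooth_distribution :: "'a::euclidean_space set \<Rightarrow> ('a \<Rightarrow> 'a set) \<Rightarrow> nat \<Rightarrow> bool" where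
  "smooth_distribution M D k \<longleftrightarrow>
     (\<forall>p\<in>M. subspace (D p) \<and> dim (D p) = k) \<and>
     (\<forall>p\<in>M. \<exists>U. open U \<and> p \<in> U \<and> U \<subseteq> M \<and>
        (\<exists>X :: nat \<Rightarrow> 'a \<Rightarrow> 'a. (\<forall>i<k. smooth_field U (X i)) \<and>
           (\<forall>q\<in>U. D q = span ((\<lambda>i. X i q) ` {..<k}))))"

inductive_set lie_fields :: "('a::euclidean_space \<Rightarrow> 'a set) \<Rightarrow> 'a set \<Rightarrow> ('a \<Rightarrow> 'a) set"
  for D U where
  base: "horizontal_field D U X \<Longrightarrow> X \<in> lie_fields D U"
| bracket: "X \<in> lie_fields D U \<Longrightarrow> Y \<in> lie_fields D U \<Longrightarrow> lie_bracket X Y \<in> lie_fields D U"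

definition bracket_generating :: "'a::euclidean_space set \<Rightarrow> ('a \<Rightarrow> 'a set) \<Rightarrow> bool" where
  "bracket_generating M D \<longleftrightarrow>
     (\<forall>p\<in>M. \<exists>U. open U \<and> p \<in> U \<and> U \<subseteq> M \<and>
        span ((\<lambda>X. X p) ` lie_fields D U) = UNIV)"

definition sub_lorentzian_metric ::
  "'a::euclidean_space set \<Rightarrow> ('a \<Rightarrow> 'a set) \<Rightarrow> ('a \<Rightarrow> 'a \<Rightarrow> 'a \<Rightarrow> real) \<Rightarrow> bool" where
  "sub_lorentzian_metric M D g \<longleftrightarrow>
     (\<forall>p\<in>M.
        (\<forall>u\<in>D p. \<forall>v\<in>D p. g p u v = g p v u) \<and>
        (\<forall>a b. \<forall>u\<in>D p. \<forall>v\<in>D p. \<forall>w\<in>D p.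
            g p (a *\<^sub>R u + b *\<^sub>R v) w = a * g p u w + b * g p v w) \<and>
        (\<forall>v\<in>D p. (\<forall>w\<in>D p. g p v w = 0) \<longrightarrow> v = 0) \<and>
        (\<exists>v\<in>D p. g p v v < 0) \<and>
        (\<forall>W. subspace W \<and> W \<subseteq> D p \<and> (\<forall>w\<in>W. w \<noteq> 0 \<longrightarrow> g p w w < 0) \<longrightarrow> dim W \<le> 1)) \<and>
     (\<forall>U X Y. open U \<and> U \<subseteq> M \<and> horizontal_field D U X \<and> horizontal_field D U Y \<longrightarrow>
        smooth_on U (\<lambda>q. g q (X q) (Y q)))"

definition sub_space_time ::
  "'a::euclidean_space set \<Rightarrow> ('a \<Rightarrow> 'a set) \<Rightarrow> ('a \<Rightarrow> 'a \<Rightarrow> 'a \<Rightarrow> real) \<Rightarrow> ('a \<Rightarrow> 'a) \<Rightarrow> nat \<Rightarrow> bool" where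
  "sub_space_time M D g T k \<longleftrightarrow>
     open M \<and> connected M \<and> M \<noteq> {} \<and>
     2 \<le> k \<and> k < DIM('a) \<and>
     smooth_distribution M D k \<and> bracket_generating M D \<and>
     sub_lorentzian_metric M D g \<and>
     horizontal_field D M T \<and> (\<forall>p\<in>M. g p (T p) (T p) < 0)"

definition absolutely_continuous_on :: "real set \<Rightarrow> (real \<Rightarrow> 'a::real_normed_vector) \<Rightarrow> bool" where
  "absolutely_continuous_on S f \<longleftrightarrow>
     (\<forall>\<epsilon>>0. \<exists>\<delta>>0. \<forall>(n::nat) (a::nat \<Rightarrow> real) b.
        (\<forall>i<n. a i \<le> b i \<and> {a i..b i} \<subseteq> S) \<and>
        (\<forall>i<n. \<forall>j<n. i \<noteq> j \<longrightarrow> b i \<le> a j \<or> b j \<le> a i) \<and>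
        (\<Sum>i<n. b i - a i) < \<delta> \<longrightarrow>
        (\<Sum>i<n. norm (f (b i) - f (a i))) < \<epsilon>)"

text \<open>gamma : [0,1] -> M horizontal with a.e. derivative gamma'; square integrability is
  w.r.t. the Euclidean metric (equivalent on compact sets to any Riemannian metric).\<close>
definition horizontal_curve ::
  "'a::euclidean_space set \<Rightarrow> ('a \<Rightarrow> 'a set) \<Rightarrow> (real \<Rightarrow> 'a) \<Rightarrow> (real \<Rightarrow> 'a) \<Rightarrow> bool" where
  "horizontal_curve M D \<gamma> \<gamma>' \<longleftrightarrow>
     \<gamma> ` {0..1} \<subseteq> M \<and> absolutely_continuous_on {0..1} \<gamma> \<and>
     (AE t in lebesgue_on {0..1}. (\<gamma> has_vector_derivative \<gamma>' t) (at t within {0..1}) \<and> \<gamma>' t \<in> D (\<gamma> t)) \<and>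
     \<gamma>' \<in> borel_measurable (lebesgue_on {0..1}) \<and>
     integrable (lebesgue_on {0..1}) (\<lambda>t. (norm (\<gamma>' t))\<^sup>2)"

definition timelike_fd where
  "timelike_fd M D g T \<gamma> \<gamma>' \<longleftrightarrow> horizontal_curve M D \<gamma> \<gamma>' \<and>
     (AE t in lebesgue_on {0..1}. g (\<gamma> t) (\<gamma>' t) (\<gamma>' t) < 0 \<and> g (\<gamma> t) (T (\<gamma> t)) (\<gamma>' t) < 0)"

definition nonspacelike_fd where
  "nonspacelike_fd M D g T \<gamma> \<gamma>' \<longleftrightarrow> horizontal_curve M D \<gamma> \<gamma>' \<and>
     (AE t in lebesgue_on {0..1}. g (\<gamma> t) (\<gamma>' t) (\<gamma>' t) \<le> 0 \<and> \<gamma>' t \<noteq> 0 \<and>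
        g (\<gamma> t) (T (\<gamma> t)) (\<gamma>' t) < 0)"

definition chron :: "'a::euclidean_space set \<Rightarrow> ('a \<Rightarrow> 'a set) \<Rightarrow> ('a \<Rightarrow> 'a \<Rightarrow> 'a \<Rightarrow> real) \<Rightarrow> ('a \<Rightarrow> 'a) \<Rightarrow> 'a \<Rightarrow> 'a \<Rightarrow> bool" where
  "chron M D g T p q \<longleftrightarrow> (\<exists>\<gamma> \<gamma>'. timelike_fd M D g T \<gamma> \<gamma>' \<and> \<gamma> 0 = p \<and> \<gamma> 1 = q)"

definition I_fut where "I_fut M D g T p = {q. chron M D g T p q}"
definition I_past where "I_past M D g T p = {q. chron M D g T q p}"

text \<open>Time separation function, valued in [0, infinity]; the supremum over the empty set is 0.\<close>
definition time_sep :: "'a::euclidean_space set \<Rightarrow> ('a \<Rightarrow> 'a set) \<Rightarrow> ('a \<Rightarrow> 'a \<Rightarrow> 'a \<Rightarrow> real) \<Rightarrow> ('a \<Rightarrow> 'a) \<Rightarrow> 'a \<Rightarrow> 'a \<Rightarrow> ennreal" where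
  "time_sep M D g T p q =
     (SUP c \<in> {(\<gamma>, \<gamma>'). nonspacelike_fd M D g T \<gamma> \<gamma>' \<and> \<gamma> 0 = p \<and> \<gamma> 1 = q}.
        (\<integral>\<^sup>+ t. ennreal (sqrt (- g (fst c t) (snd c t) (snd c t))) \<partial>lebesgue_on {0..1}))"

definition O_fut where "O_fut M D g T p \<epsilon> = {q \<in> M. ennreal \<epsilon> < time_sep M D g T p q}"
definition O_past where "O_past M D g T p \<epsilon> = {q \<in> M. ennreal \<epsilon> < time_sep M D g T q p}"

text \<open>Topologies on M generated by the subbases (M itself included as the empty intersection).\<close>
definition alexandrov_topology where
  "alexandrov_topology M D g T = topology_generated_by
     (insert M ((I_fut M D g T ` M) \<union> (I_past M D g T ` M)))"

definition tsep_topology where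
  "tsep_topology M D g T = topology_generated_by
     (insert M ({O_fut M D g T p \<epsilon> | p \<epsilon>. p \<in> M \<and> \<epsilon> > 0} \<union>
                {O_past M D g T p \<epsilon> | p \<epsilon>. p \<in> M \<and> \<epsilon> > 0}))"

end

theory Submission
  imports Defs
begin

text \<open>
  On \<open>\<real>\<^sup>3\<close> with coordinates \<open>(u, v, z)\<close> take the Martinet-type distribution \<open>dz = (u - v)\<^sup>2 du\<close>
  with null frame \<open>\<partial>\<^sub>u + (u - v)\<^sup>2 \<partial>\<^sub>z\<close>, \<open>\<partial>\<^sub>v\<close>. Along a future directed causal curve \<open>u\<close>, \<open>v\<close> and
  \<open>z\<close> are nondecreasing, and \<open>z\<close> stays constant only as long as the curve runs along the (timelike)
  diagonal \<open>u = v\<close> or along \<open>\<partial>\<^sub>v\<close>. The point \<open>q = (0, 1, 0)\<close> is reached from \<open>p = (-1, -1, 0)\<close> by a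
  diagonal segment followed by a null segment, so that \<open>T(p, q) > 1/2\<close>, whereas
  \<open>T(p, q - c e\<^sub>3) = 0\<close> for all \<open>c > 0\<close> because \<open>z\<close> cannot decrease. Hence \<open>O\<^sup>+(p, 1/2)\<close> contains \<open>q\<close>
  but none of the points \<open>q - c e\<^sub>3\<close>.

  On the other hand, every Alexandrov neighbourhood of \<open>q\<close> contains \<open>q - c e\<^sub>3\<close> for all small
  \<open>c > 0\<close>. Near \<open>q\<close> we have \<open>u < v\<close>, so the increment of \<open>z\<close> along a timelike arc near \<open>q\<close> lies strictly
  between its values on the two broken null arcs with the same \<open>(u, v)\<close>-endpoints; all values in
  between are attained by explicit timelike arcs. Replacing the arc therefore shifts the height of
  the rest of a timelike curve through \<open>q\<close> by any small \<open>c\<close> of either sign.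
\<close>

section \<open>Absolutely continuous functions\<close>

text \<open>Index sets are finite sets of an arbitrary type, so that the cells of a division, or a
  single interval, form a family without being enumerated.\<close>

definition interval_family :: "real set \<Rightarrow> 'i set \<Rightarrow> ('i \<Rightarrow> real) \<Rightarrow> ('i \<Rightarrow> real) \<Rightarrow> bool" where
  "interval_family S I a b \<longleftrightarrow> finite I \<and> (\<forall>i\<in>I. a i \<le> b i \<and> {a i..b i} \<subseteq> S) \<and>
     (\<forall>i\<in>I. \<forall>j\<in>I. i \<noteq> j \<longrightarrow> b i \<le> a j \<or> b j \<le> a i)"

lemma absolutely_continuous_onI:
  fixes f :: "real \<Rightarrow> 'a::real_normed_vector"
  assumes "\<And>\<epsilon>. \<epsilon> > 0 \<Longrightarrow> \<exists>\<delta>>0. \<forall>(n::nat) a b. interval_family S {..<n} a b \<longrightarrow>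
      (\<Sum>i<n. b i - a i) < \<delta> \<longrightarrow> (\<Sum>i<n. norm (f (b i) - f (a i))) < \<epsilon>"
  shows "absolutely_continuous_on S f"
  unfolding absolutely_continuous_on_def
proof (intro allI impI)
  fix \<epsilon> :: real assume "\<epsilon> > 0"
  from assms[OF this] obtain \<delta> where "\<delta> > 0" and \<delta>: "\<And>(n::nat) a b. interval_family S {..<n} a b \<Longrightarrow>
      (\<Sum>i<n. b i - a i) < \<delta> \<Longrightarrow> (\<Sum>i<n. norm (f (b i) - f (a i))) < \<epsilon>"
    by blast
  show "\<exists>\<delta>>0. \<forall>n (a::nat \<Rightarrow> real) b. (\<forall>i<n. a i \<le> b i \<and> {a i..b i} \<subseteq> S) \<and>
          (\<forall>i<n. \<forall>j<n. i \<noteq> j \<longrightarrow> b i \<le> a j \<or> b j \<le> a i) \<and> (\<Sum>i<n. b i - a i) < \<delta> \<longrightarrow>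
          (\<Sum>i<n. norm (f (b i) - f (a i))) < \<epsilon>"
    using \<open>\<delta> > 0\<close> by (intro exI[of _ \<delta>] conjI allI impI \<delta>) (auto simp: interval_family_def)
qed

text \<open>A bijection from \<open>{..<card I}\<close> to \<open>I\<close> turns any finite family
  into a sequence, to which the definition applies. The \<delta> is the same for all families with
  indices in \<open>'i\<close>.\<close>

lemma absolutely_continuous_onD:
  fixes f :: "real \<Rightarrow> 'a::real_normed_vector"
  assumes f: "absolutely_continuous_on S f" and "\<epsilon> > 0"
  shows "\<exists>\<delta>>0. \<forall>(I::'i set) a b. interval_family S I a b \<longrightarrow>
      (\<Sum>i\<in>I. b i - a i) < \<delta> \<longrightarrow> (\<Sum>i\<in>I. norm (f (b i) - f (a i))) < \<epsilon>"
proof -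
  from f[unfolded absolutely_continuous_on_def, THEN spec, THEN mp, OF \<open>\<epsilon> > 0\<close>]
  obtain \<delta> where "\<delta> > 0" and
    \<delta>: "\<forall>(n::nat) a b. (\<forall>i<n. a i \<le> b i \<and> {a i..b i} \<subseteq> S) \<and>
          (\<forall>i<n. \<forall>j<n. i \<noteq> j \<longrightarrow> b i \<le> a j \<or> b j \<le> a i) \<and>
          (\<Sum>i<n. b i - a i) < \<delta> \<longrightarrow> (\<Sum>i<n. norm (f (b i) - f (a i))) < \<epsilon>"
    by (elim exE conjE) (rule that)
  show ?thesis
  proof (intro exI[of _ \<delta>] conjI allI impI \<open>\<delta> > 0\<close>)
    fix I :: "'i set" and a b :: "'i \<Rightarrow> real"
    assume fam: "interval_family S I a b" and sm: "(\<Sum>i\<in>I. b i - a i) < \<delta>"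
    obtain h where h: "bij_betw h {..<card I} I"
      using ex_bij_betw_nat_finite[of I] fam by (auto simp: atLeast0LessThan interval_family_def)
    have hI: "h k \<in> I" if "k < card I" for k
      using h that by (auto simp: bij_betw_def)
    have hne: "h k \<noteq> h l" if "k < card I" "l < card I" "k \<noteq> l" for k l
      using h that by (auto simp: bij_betw_def inj_on_def)
    have "(\<Sum>k<card I. norm (f (b (h k)) - f (a (h k)))) < \<epsilon>"
    proof (rule \<delta>[THEN spec[of _ "card I"], THEN spec[of _ "\<lambda>k. a (h k)"],
            THEN spec[of _ "\<lambda>k. b (h k)"], THEN mp], intro conjI)
      show "\<forall>i<card I. a (h i) \<le> b (h i) \<and> {a (h i)..b (h i)} \<subseteq> S"
        using fam hI by (simp add: interval_family_def)
      show "\<forall>i<card I. \<forall>j<card I. i \<noteq> j \<longrightarrow> b (h i) \<le> a (h j) \<or> b (h j) \<le> a (h i)"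
        using fam hI hne by (simp add: interval_family_def)
      show "(\<Sum>i<card I. b (h i) - a (h i)) < \<delta>"
        using sm sum.reindex_bij_betw[OF h, of "\<lambda>i. b i - a i"] by simp
    qed
    then show "(\<Sum>i\<in>I. norm (f (b i) - f (a i))) < \<epsilon>"
      using sum.reindex_bij_betw[OF h, of "\<lambda>i. norm (f (b i) - f (a i))"] by simp
  qed
qed

text \<open>A Lipschitz map enlarges sums of increments by at most its constant. The bound is asked
  for on the image of \<open>f\<close> alone, so that locally Lipschitz maps such as cubes are
  covered when \<open>f\<close> is bounded.\<close>

lemma absolutely_continuous_on_lipschitz_compose:
  fixes f :: "real \<Rightarrow> 'a::real_normed_vector" and h :: "'a \<Rightarrow> 'b::real_normed_vector"
  assumes f: "absolutely_continuous_on S f"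
    and h: "\<And>x y. x \<in> S \<Longrightarrow> y \<in> S \<Longrightarrow> norm (h (f x) - h (f y)) \<le> C * norm (f x - f y)"
  shows "absolutely_continuous_on S (\<lambda>x. h (f x))"
proof (rule absolutely_continuous_onI)
  fix \<epsilon> :: real assume "\<epsilon> > 0"
  \<comment> \<open>\<open>C\<close> may be zero or negative; \<open>B\<close> dominates it and is a
    positive divisor.\<close>
  define B where "B = \<bar>C\<bar> + 1"
  have "B > 0" by (simp add: B_def)
  then have "\<epsilon> / B > 0"
    using \<open>\<epsilon> > 0\<close> by simp
  from absolutely_continuous_onD[OF f this] obtain \<delta> where "\<delta> > 0" and
    \<delta>: "\<And>(I::nat set) a b. interval_family S I a b \<Longrightarrow>
        (\<Sum>i\<in>I. b i - a i) < \<delta> \<Longrightarrow> (\<Sum>i\<in>I. norm (f (b i) - f (a i))) < \<epsilon> / B"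
    by blast
  have "(\<Sum>i<n. norm (h (f (b i)) - h (f (a i)))) < \<epsilon>"
    if fam: "interval_family S {..<n} a b" and sm: "(\<Sum>i<n. b i - a i) < \<delta>" for n :: nat and a b
  proof -
    have le: "norm (h (f (b i)) - h (f (a i))) \<le> B * norm (f (b i) - f (a i))" if "i < n" for i
    proof -
      have "a i \<le> b i" "{a i..b i} \<subseteq> S"
        using fam that unfolding interval_family_def by auto
      then have "a i \<in> S" "b i \<in> S"
        by (meson atLeastAtMost_iff order_refl subsetD)+
      then have "norm (h (f (b i)) - h (f (a i))) \<le> C * norm (f (b i) - f (a i))"
        by (intro h)
      also have "\<dots> \<le> B * norm (f (b i) - f (a i))"
        by (intro mult_right_mono) (auto simp: B_def)
      finally show ?thesis .
    qed
    have "(\<Sum>i<n. norm (h (f (b i)) - h (f (a i)))) \<le> B * (\<Sum>i<n. norm (f (b i) - f (a i)))"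
      unfolding sum_distrib_left using le by (intro sum_mono) auto
    also have "\<dots> < B * (\<epsilon> / B)"
      using \<open>B > 0\<close> by (intro mult_strict_left_mono \<delta>[OF fam sm])
    finally show ?thesis
      using \<open>B > 0\<close> by simp
  qed
  then show "\<exists>\<delta>>0. \<forall>(n::nat) a b. interval_family S {..<n} a b \<longrightarrow>
      (\<Sum>i<n. b i - a i) < \<delta> \<longrightarrow> (\<Sum>i<n. norm (h (f (b i)) - h (f (a i)))) < \<epsilon>"
    using \<open>\<delta> > 0\<close> by blast
qed

lemma absolutely_continuous_on_lipschitz:
  fixes h :: "real \<Rightarrow> 'b::real_normed_vector"
  assumes "\<And>x y. x \<in> S \<Longrightarrow> y \<in> S \<Longrightarrow> norm (h x - h y) \<le> C * \<bar>x - y\<bar>"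
  shows "absolutely_continuous_on S h"
proof -
  have "absolutely_continuous_on S (\<lambda>x::real. x)"
    by (rule absolutely_continuous_onI) (auto simp: interval_family_def)
  then show ?thesis
    using absolutely_continuous_on_lipschitz_compose[of S "\<lambda>x. x" h C] assms by simp
qed

lemma absolutely_continuous_on_add:
  fixes f g :: "real \<Rightarrow> 'a::real_normed_vector"
  assumes f: "absolutely_continuous_on S f" and g: "absolutely_continuous_on S g"
  shows "absolutely_continuous_on S (\<lambda>x. f x + g x)"
proof (rule absolutely_continuous_onI)
  fix \<epsilon> :: real assume "\<epsilon> > 0"
  then have "\<epsilon> / 2 > 0" by simp
  from absolutely_continuous_onD[OF f this] obtain \<delta> where "\<delta> > 0" and
    \<delta>: "\<And>(I::nat set) a b. interval_family S I a b \<Longrightarrow>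
        (\<Sum>i\<in>I. b i - a i) < \<delta> \<Longrightarrow> (\<Sum>i\<in>I. norm (f (b i) - f (a i))) < \<epsilon> / 2"
    by blast
  from absolutely_continuous_onD[OF g \<open>\<epsilon> / 2 > 0\<close>] obtain \<eta> where "\<eta> > 0" and
    \<eta>: "\<And>(I::nat set) a b. interval_family S I a b \<Longrightarrow>
        (\<Sum>i\<in>I. b i - a i) < \<eta> \<Longrightarrow> (\<Sum>i\<in>I. norm (g (b i) - g (a i))) < \<epsilon> / 2"
    by blast
  have "(\<Sum>i<n. norm (f (b i) + g (b i) - (f (a i) + g (a i)))) < \<epsilon>"
    if fam: "interval_family S {..<n} a b" and sm: "(\<Sum>i<n. b i - a i) < min \<delta> \<eta>"
    for n :: nat and a b
  proof -
    have "(\<Sum>i<n. norm (f (b i) + g (b i) - (f (a i) + g (a i))))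
        \<le> (\<Sum>i<n. norm (f (b i) - f (a i)) + norm (g (b i) - g (a i)))"
      by (intro sum_mono) (metis add_diff_add norm_triangle_ineq)
    also have "\<dots> = (\<Sum>i<n. norm (f (b i) - f (a i))) + (\<Sum>i<n. norm (g (b i) - g (a i)))"
      by (rule sum.distrib)
    also have "\<dots> < \<epsilon> / 2 + \<epsilon> / 2"
      using sm by (intro add_strict_mono \<delta>[OF fam] \<eta>[OF fam]) auto
    finally show ?thesis
      by simp
  qed
  then show "\<exists>\<delta>>0. \<forall>(n::nat) a b. interval_family S {..<n} a b \<longrightarrow>
      (\<Sum>i<n. b i - a i) < \<delta> \<longrightarrow> (\<Sum>i<n. norm (f (b i) + g (b i) - (f (a i) + g (a i)))) < \<epsilon>"
    using \<open>\<delta> > 0\<close> \<open>\<eta> > 0\<close> by (intro exI[of _ "min \<delta> \<eta>"]) auto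
qed

lemma absolutely_continuous_on_subset:
  fixes f :: "real \<Rightarrow> 'a::real_normed_vector"
  assumes f: "absolutely_continuous_on S f" and "R \<subseteq> S"
  shows "absolutely_continuous_on R f"
proof (rule absolutely_continuous_onI)
  fix \<epsilon> :: real assume "\<epsilon> > 0"
  have "interval_family S I a b" if "interval_family R I a b" for I :: "nat set" and a b
    using that \<open>R \<subseteq> S\<close> unfolding interval_family_def by blast
  then show "\<exists>\<delta>>0. \<forall>(n::nat) a b. interval_family R {..<n} a b \<longrightarrow>
      (\<Sum>i<n. b i - a i) < \<delta> \<longrightarrow> (\<Sum>i<n. norm (f (b i) - f (a i))) < \<epsilon>"
    using absolutely_continuous_onD[OF f \<open>\<epsilon> > 0\<close>, where 'i = nat] by meson
qed

text \<open>A nondecreasing map that does not increase lengths sends non-overlapping intervals to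
  non-overlapping intervals of no larger total length. The clamps \<open>min t a\<close> and
  \<open>max t b\<close>, used later to cut a curve into pieces, are of this kind.\<close>

lemma absolutely_continuous_on_reparam:
  fixes f :: "real \<Rightarrow> 'a::real_normed_vector" and r :: "real \<Rightarrow> real"
  assumes f: "absolutely_continuous_on S f"
    and r: "\<And>x y. x \<le> y \<Longrightarrow> r x \<le> r y" "\<And>x y. x \<le> y \<Longrightarrow> r y - r x \<le> y - x"
    and im: "\<And>x y. x \<le> y \<Longrightarrow> {x..y} \<subseteq> R \<Longrightarrow> {r x..r y} \<subseteq> S"
  shows "absolutely_continuous_on R (\<lambda>x. f (r x))"
proof (rule absolutely_continuous_onI)
  fix \<epsilon> :: real assume "\<epsilon> > 0"
  from absolutely_continuous_onD[OF f this] obtain \<delta> where "\<delta> > 0" and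
    \<delta>: "\<And>(I::nat set) a b. interval_family S I a b \<Longrightarrow>
        (\<Sum>i\<in>I. b i - a i) < \<delta> \<Longrightarrow> (\<Sum>i\<in>I. norm (f (b i) - f (a i))) < \<epsilon>"
    by blast
  have "(\<Sum>i<n. norm (f (r (b i)) - f (r (a i)))) < \<epsilon>"
    if fam: "interval_family R {..<n} a b" and sm: "(\<Sum>i<n. b i - a i) < \<delta>" for n :: nat and a b
  proof (rule \<delta>)
    have "(\<Sum>i<n. r (b i) - r (a i)) \<le> (\<Sum>i<n. b i - a i)"
      using fam r(2) by (intro sum_mono) (auto simp: interval_family_def)
    then show "(\<Sum>i<n. r (b i) - r (a i)) < \<delta>"
      using sm by linarith
    have "r (a i) \<le> r (b i)" "{r (a i)..r (b i)} \<subseteq> S" if "i < n" for i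
      using fam that r(1) im[of "a i" "b i"] by (auto simp: interval_family_def)
    moreover have "r (b i) \<le> r (a j) \<or> r (b j) \<le> r (a i)" if "i < n" "j < n" "i \<noteq> j" for i j
      using fam that r(1) unfolding interval_family_def by blast
    ultimately show "interval_family S {..<n} (\<lambda>i. r (a i)) (\<lambda>i. r (b i))"
      by (simp add: interval_family_def)
  qed
  then show "\<exists>\<delta>>0. \<forall>(n::nat) a b. interval_family R {..<n} a b \<longrightarrow>
      (\<Sum>i<n. b i - a i) < \<delta> \<longrightarrow> (\<Sum>i<n. norm (f (r (b i)) - f (r (a i)))) < \<epsilon>"
    using \<open>\<delta> > 0\<close> by blast
qed

lemma absolutely_continuous_on_imp_continuous_on:
  fixes f :: "real \<Rightarrow> 'a::real_normed_vector"
  assumes f: "absolutely_continuous_on {a..b} f"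
  shows "continuous_on {a..b} f"
  unfolding continuous_on_iff
proof (intro ballI allI impI)
  fix x \<epsilon> :: real assume x: "x \<in> {a..b}" and "\<epsilon> > 0"
  from absolutely_continuous_onD[OF f \<open>\<epsilon> > 0\<close>] obtain \<delta> where "\<delta> > 0" and
    \<delta>: "\<And>(I::unit set) l u. interval_family {a..b} I l u \<Longrightarrow>
        (\<Sum>i\<in>I. u i - l i) < \<delta> \<Longrightarrow> (\<Sum>i\<in>I. norm (f (u i) - f (l i))) < \<epsilon>"
    by blast
  have "dist (f y) (f x) < \<epsilon>" if y: "y \<in> {a..b}" "dist y x < \<delta>" for y
  proof -
    \<comment> \<open>The interval between the two points is a family by itself, indexed by the type
      \<open>unit\<close>.\<close>
    have "norm (f (max x y) - f (min x y)) < \<epsilon>"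
      using \<delta>[of UNIV "\<lambda>_. min x y" "\<lambda>_. max x y"] x y
      by (auto simp: interval_family_def dist_real_def max_def min_def split: if_splits)
    then show ?thesis
      by (auto simp: max_def min_def dist_norm norm_minus_commute split: if_splits)
  qed
  then show "\<exists>d>0. \<forall>y\<in>{a..b}. dist y x < d \<longrightarrow> dist (f y) (f x) < \<epsilon>"
    using \<open>\<delta> > 0\<close> by blast
qed

section \<open>Monotonicity from derivatives known almost everywhere\<close>

lemma AE_lebesgue_on_E:
  assumes "AE t in lebesgue_on S. P t" "S \<in> sets lebesgue"
  obtains N where "negligible N" "\<And>t. t \<in> S \<Longrightarrow> t \<notin> N \<Longrightarrow> P t"
proof -
  have "AE t in lebesgue. t \<in> S \<longrightarrow> P t"
    using assms by (simp add: AE_restrict_space_iff)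
  then show ?thesis
    using that unfolding eventually_ae_filter_negligible by blast
qed

lemma AE_lebesgue_on_I:
  assumes "negligible N" "S \<in> sets lebesgue" "\<And>t. t \<in> S \<Longrightarrow> t \<notin> N \<Longrightarrow> P t"
  shows "AE t in lebesgue_on S. P t"
proof -
  have "AE t in lebesgue. t \<in> S \<longrightarrow> P t"
    unfolding eventually_ae_filter_negligible using assms by blast
  then show ?thesis
    using assms by (simp add: AE_restrict_space_iff)
qed

text \<open>Fine tagged division: off the null set the gauge comes from the derivative, on the null set
  from an open cover of small measure, where absolute continuity bounds the increments.\<close>

lemma absolutely_continuous_on_imp_mono:
  fixes f :: "real \<Rightarrow> real"
  assumes f: "absolutely_continuous_on {a..b} f" and "a \<le> b" and N: "negligible N"
    and D: "\<And>t. t \<in> {a..b} \<Longrightarrow> t \<notin> N \<Longrightarrow> \<exists>d\<ge>0. (f has_vector_derivative d) (at t within {a..b})"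
  shows "f a \<le> f b"
proof (rule field_le_epsilon)
  fix e :: real assume "e > 0"
  \<comment> \<open>The budget \<open>e\<close> is split: cells tagged off the null set cost at most
    \<open>\<epsilon> * (b - a)\<close> in total, those tagged in it at most \<epsilon>.\<close>
  define \<epsilon> where "\<epsilon> = e / (b - a + 1)"
  have "\<epsilon> > 0"
    using \<open>e > 0\<close> \<open>a \<le> b\<close> by (simp add: \<epsilon>_def)
  have "\<epsilon> * (b - a + 1) = e"
    using \<open>a \<le> b\<close> by (simp add: \<epsilon>_def)
  then have e: "\<epsilon> * (b - a) + \<epsilon> = e"
    by (simp add: algebra_simps)
  from absolutely_continuous_onD[OF f \<open>\<epsilon> > 0\<close>] obtain \<delta> where "\<delta> > 0" and
    \<delta>: "\<And>(I::(real set) set) l u. interval_family {a..b} I l u \<Longrightarrow>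
        (\<Sum>i\<in>I. u i - l i) < \<delta> \<Longrightarrow> (\<Sum>i\<in>I. norm (f (u i) - f (l i))) < \<epsilon>"
    by blast
  obtain G where G: "open G" "N \<subseteq> G" "G - N \<in> lmeasurable" "emeasure lebesgue (G - N) < ennreal \<delta>"
    using sets_lebesgue_outer_open[of N \<delta>] N \<open>\<delta> > 0\<close> negligible_imp_sets by blast
  have "G \<in> lmeasurable" and mG: "measure lebesgue G < \<delta>"
  proof -
    have "G = (G - N) \<union> N"
      using G(2) by blast
    then show "G \<in> lmeasurable"
      using G(3) N by (metis fmeasurable.Un negligible_imp_measurable)
    have "measure lebesgue G = measure lebesgue (G - N)"
      using measure_negligible_symdiff[of G "G - N"] \<open>G \<in> lmeasurable\<close> N
      by (metis G(3) Un_Diff_cancel2 \<open>G = G - N \<union> N\<close> measure_Un_null_set negligible_iff_null_sets fmeasurableD)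
    then show "measure lebesgue G < \<delta>"
      using G(3,4) \<open>\<delta> > 0\<close> by (simp add: emeasure_eq_measure2 ennreal_less_iff)
  qed
  \<comment> \<open>Straddling estimate: \<open>f y\<close> and \<open>f x\<close> are both compared
    with \<open>f t\<close>, the linear terms are nonnegative, and the two errors add up to
    \<open>\<epsilon> * (y - x)\<close> because \<open>t\<close> lies between \<open>x\<close> and
    \<open>y\<close>.\<close>
  have ex: "\<exists>r>0. \<forall>x y. x \<in> {a..b} \<longrightarrow> y \<in> {a..b} \<longrightarrow> x \<le> t \<longrightarrow> t \<le> y \<longrightarrow> \<bar>x - t\<bar> < r \<longrightarrow> \<bar>y - t\<bar> < r \<longrightarrow>
      f y - f x \<ge> - \<epsilon> * (y - x)" if t: "t \<in> {a..b}" "t \<notin> N" for t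
  proof -
    obtain d where "d \<ge> 0" and d: "(f has_vector_derivative d) (at t within {a..b})"
      using D[OF t] by blast
    from d obtain r where "r > 0" and
      r: "\<And>y. y \<in> {a..b} \<Longrightarrow> norm (y - t) < r \<Longrightarrow> norm (f y - f t - (y - t) *\<^sub>R d) \<le> \<epsilon> * norm (y - t)"
      unfolding has_vector_derivative_def has_derivative_within_alt using \<open>\<epsilon> > 0\<close> by blast
    have "f y - f x \<ge> - \<epsilon> * (y - x)"
      if "x \<in> {a..b}" "y \<in> {a..b}" "x \<le> t" "t \<le> y" "\<bar>x - t\<bar> < r" "\<bar>y - t\<bar> < r" for x y
    proof -
      have "\<bar>f y - f t - (y - t) * d\<bar> \<le> \<epsilon> * (y - t)" "\<bar>f x - f t - (x - t) * d\<bar> \<le> \<epsilon> * (t - x)"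
        using r[of y] r[of x] that by auto
      then have "f y - f t \<ge> (y - t) * d - \<epsilon> * (y - t)" "f t - f x \<ge> (t - x) * d - \<epsilon> * (t - x)"
        by (auto simp: abs_le_iff algebra_simps)
      moreover have "(y - t) * d \<ge> 0" "(t - x) * d \<ge> 0"
        using that \<open>d \<ge> 0\<close> by auto
      ultimately show ?thesis
        by (simp add: algebra_simps)
    qed
    then show ?thesis
      using \<open>r > 0\<close> by blast
  qed
  obtain r where rpos: "\<And>t. t \<in> {a..b} \<Longrightarrow> t \<notin> N \<Longrightarrow> r t > 0" and
    r: "\<And>t x y. t \<in> {a..b} \<Longrightarrow> t \<notin> N \<Longrightarrow> x \<in> {a..b} \<Longrightarrow> y \<in> {a..b} \<Longrightarrow> x \<le> t \<Longrightarrow> t \<le> y \<Longrightarrow>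
      \<bar>x - t\<bar> < r t \<Longrightarrow> \<bar>y - t\<bar> < r t \<Longrightarrow> f y - f x \<ge> - \<epsilon> * (y - x)"
    using ex by metis
  define \<gamma> where "\<gamma> t = (if t \<in> N then G else if t \<in> {a..b} then ball t (r t) else UNIV)" for t
  have "gauge \<gamma>"
    unfolding gauge_def \<gamma>_def using G rpos by auto
  then obtain p where p: "p tagged_division_of {a..b}" and fine: "\<gamma> fine p"
    using fine_division_exists_real by blast
  have "finite p"
    using p by blast
  have pk: "\<exists>l u. k = {l..u} \<and> l \<le> x \<and> x \<le> u \<and> a \<le> l \<and> u \<le> b" if "(x, k) \<in> p" for x k
    using tagged_division_ofD(2-4)[OF p that] by (metis atLeastAtMost_iff atLeastatMost_subset_iff box_real(2) order_trans subsetD)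
  \<comment> \<open>\<open>B\<close> holds the cells of positive length with a tag in
    \<open>N\<close>. Degenerate cells have zero increment and are counted as good; without them
    \<open>snd\<close> is injective on \<open>B\<close>, and disjoint interiors put the cells in
    order on the line.\<close>
  define B where "B = {(x, k). (x, k) \<in> p \<and> x \<in> N \<and> Inf k < Sup k}"
  have "B \<subseteq> p"
    by (auto simp: B_def)
  have good: "f (Sup k) - f (Inf k) \<ge> - \<epsilon> * (Sup k - Inf k)" if xk: "(x, k) \<in> p - B" for x k
  proof -
    obtain l u where k: "k = {l..u}" "l \<le> x" "x \<le> u" "a \<le> l" "u \<le> b"
      using pk[of x k] xk by blast
    show ?thesis
    proof (cases "l = u")
      case False
      then have "x \<notin> N"
        using xk k by (auto simp: B_def)
      moreover have "k \<subseteq> \<gamma> x"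
        using fine xk unfolding fine_def by blast
      then have "k \<subseteq> ball x (r x)"
        using k \<open>x \<notin> N\<close> by (simp add: \<gamma>_def)
      then have "l \<in> ball x (r x)" "u \<in> ball x (r x)"
        using k by (auto simp del: mem_ball)
      ultimately show ?thesis
        using r[of x l u] k by (auto simp: dist_real_def abs_minus_commute)
    qed (use k in auto)
  qed
  have part: "B tagged_partial_division_of {a..b}"
    using tagged_partial_division_subset[OF _ \<open>B \<subseteq> p\<close>] p tagged_division_of_def by blast
  define I where "I = snd ` B"
  have div: "I division_of \<Union>I"
    unfolding I_def by (rule partial_division_of_tagged_division[OF part])
  have Ik: "\<exists>l u. k = {l..u} \<and> l < u \<and> a \<le> l \<and> u \<le> b \<and> k \<subseteq> G" if kI: "k \<in> I" for k
  proof -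
    obtain x where x: "(x, k) \<in> p" "x \<in> N" "Inf k < Sup k"
      using kI by (auto simp: I_def B_def)
    have "k \<subseteq> \<gamma> x"
      using fine x unfolding fine_def by blast
    then have "k \<subseteq> G"
      using x by (simp add: \<gamma>_def)
    moreover obtain l u where "k = {l..u}" "l \<le> x" "x \<le> u" "a \<le> l" "u \<le> b"
      using pk[OF x(1)] by blast
    moreover from this have "l < u"
      using x(3) by simp
    ultimately show ?thesis
      by blast
  qed
  have fam: "interval_family {a..b} I Inf Sup"
    unfolding interval_family_def
  proof (intro conjI ballI impI)
    show "finite I"
      using div by blast
    fix k assume "k \<in> I"
    then obtain l u where k: "k = {l..u}" "l < u" "a \<le> l" "u \<le> b"
      using Ik by blast
    then show "Inf k \<le> Sup k" "{Inf k..Sup k} \<subseteq> {a..b}"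
      by auto
    fix k' assume "k' \<in> I" "k \<noteq> k'"
    then obtain l' u' where k': "k' = {l'..u'}" "l' < u'"
      using Ik by blast
    have "interior k \<inter> interior k' = {}"
      using div \<open>k \<in> I\<close> \<open>k' \<in> I\<close> \<open>k \<noteq> k'\<close> by (meson division_ofD(5))
    then have "{l<..<u} \<inter> {l'<..<u'} = {}"
      using k k' by simp
    then have "u \<le> l' \<or> u' \<le> l"
      using k(2) k'(2) by (auto simp: greaterThanLessThan_eq_iff max_def min_def split: if_splits)
    then show "Sup k \<le> Inf k' \<or> Sup k' \<le> Inf k"
      using k k' by simp
  qed
  \<comment> \<open>All these cells lie in \<open>G\<close>, so their total length is below \<delta>
    and absolute continuity bounds the sum of their increments.\<close>
  have "(\<Sum>k\<in>I. Sup k - Inf k) = (\<Sum>k\<in>I. measure lebesgue k)"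
    using Ik by (intro sum.cong) fastforce+
  also have "\<dots> = measure lebesgue (\<Union>I)"
    by (rule content_division[OF div])
  also have "\<dots> \<le> measure lebesgue G"
    using Ik \<open>G \<in> lmeasurable\<close> div by (intro measure_mono_fmeasurable) (auto intro: fmeasurableD lmeasurable_division)
  finally have "(\<Sum>k\<in>I. norm (f (Sup k) - f (Inf k))) < \<epsilon>"
    using mG by (intro \<delta>[OF fam]) linarith
  moreover have "inj_on snd B"
  proof (rule inj_onI)
    fix X Y assume XY: "X \<in> B" "Y \<in> B" "snd X = snd Y"
    obtain l u where k: "snd X = {l..u}" "l < u"
      using Ik[of "snd X"] XY by (auto simp: I_def)
    show "X = Y"
    proof (rule ccontr)
      assume "X \<noteq> Y"
      then have "interior (snd X) \<inter> interior (snd Y) = {}"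
        using tagged_division_ofD(5)[OF p, of "fst X" "snd X" "fst Y" "snd Y"] XY(1,2) \<open>B \<subseteq> p\<close>
        by (metis prod.collapse subsetD)
      then show False
        using k XY(3) by simp
    qed
  qed
  ultimately have bad: "(\<Sum>(x, k)\<in>B. norm (f (Sup k) - f (Inf k))) < \<epsilon>"
    unfolding I_def by (simp add: sum.reindex o_def split_beta)
  have "f b - f a = (\<Sum>(x, k)\<in>p. f (Sup k) - f (Inf k))"
    using additive_tagged_division_1[OF \<open>a \<le> b\<close> p, of f] by simp
  also have "\<dots> = (\<Sum>(x, k)\<in>p - B. f (Sup k) - f (Inf k)) + (\<Sum>(x, k)\<in>B. f (Sup k) - f (Inf k))"
    by (rule sum.subset_diff[OF \<open>B \<subseteq> p\<close> \<open>finite p\<close>])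
  also have "\<dots> \<ge> (\<Sum>(x, k)\<in>p - B. - \<epsilon> * (Sup k - Inf k)) + (\<Sum>(x, k)\<in>B. - norm (f (Sup k) - f (Inf k)))"
    using good by (intro add_mono sum_mono) auto
  moreover have "(\<Sum>(x, k)\<in>p - B. - \<epsilon> * (Sup k - Inf k)) \<ge> - \<epsilon> * (b - a)"
  proof -
    have "(\<Sum>(x, k)\<in>p - B. \<epsilon> * (Sup k - Inf k)) \<le> (\<Sum>(x, k)\<in>p. \<epsilon> * (Sup k - Inf k))"
    proof (rule sum_mono2[OF \<open>finite p\<close>])
      fix z assume "z \<in> p - (p - B)"
      then have "Inf (snd z) < Sup (snd z)"
        by (auto simp: B_def)
      then show "0 \<le> (case z of (x, k) \<Rightarrow> \<epsilon> * (Sup k - Inf k))"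
        using \<open>\<epsilon> > 0\<close> by (simp add: split_beta)
    qed auto
    also have "\<dots> = \<epsilon> * (b - a)"
      using additive_tagged_division_1[OF \<open>a \<le> b\<close> p, of "\<lambda>x. \<epsilon> * x"] by (simp add: right_diff_distrib)
    finally show ?thesis
      by (simp add: split_beta sum_negf)
  qed
  moreover have "(\<Sum>(x, k)\<in>B. - norm (f (Sup k) - f (Inf k))) \<ge> - \<epsilon>"
    using bad by (simp add: split_beta sum_negf)
  ultimately have "f b - f a \<ge> - (\<epsilon> * (b - a) + \<epsilon>)"
    by linarith
  then show "f a \<le> f b + e"
    unfolding e by simp
qed

text \<open>The weak version on subintervals makes \<open>f\<close> nondecreasing. Equal end values
  would then make \<open>f\<close> constant, with derivative 0 at an interior point outside
  \<open>N\<close>, where the derivative is positive.\<close>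

lemma absolutely_continuous_on_imp_strict_mono:
  fixes f :: "real \<Rightarrow> real"
  assumes f: "absolutely_continuous_on {a..b} f" and "a < b" and N: "negligible N"
    and D: "\<And>t. t \<in> {a..b} \<Longrightarrow> t \<notin> N \<Longrightarrow> \<exists>d>0. (f has_vector_derivative d) (at t within {a..b})"
  shows "f a < f b"
proof -
  have mono: "f x \<le> f y" if "a \<le> x" "x \<le> y" "y \<le> b" for x y
  proof (rule absolutely_continuous_on_imp_mono[OF _ \<open>x \<le> y\<close> N])
    have sub: "{x..y} \<subseteq> {a..b}"
      using that by auto
    show "absolutely_continuous_on {x..y} f"
      by (rule absolutely_continuous_on_subset[OF f sub])
    show "\<exists>d\<ge>0. (f has_vector_derivative d) (at t within {x..y})" if "t \<in> {x..y}" "t \<notin> N" for t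
      using D[of t] that sub by (meson has_vector_derivative_within_subset less_imp_le subsetD)
  qed
  obtain t where t: "a < t" "t < b" "t \<notin> N"
  proof -
    have "\<not> negligible {a<..<b}"
      using \<open>a < b\<close> negligible_interval(2)[of a b] by simp
    then obtain s where "s \<in> {a<..<b}" "s \<notin> N"
      using N negligible_subset by blast
    then show ?thesis
      using that[of s] by simp
  qed
  have "f a \<noteq> f b"
  proof
    assume eq: "f a = f b"
    obtain d where "d > 0" and d: "(f has_vector_derivative d) (at t within {a..b})"
      using D[of t] t by auto
    have const: "f x = f a" if "x \<in> {a..b}" for x
      using mono[of a x] mono[of x b] that eq by auto
    have "(f has_vector_derivative 0) (at t within {a..b})"
      by (rule has_vector_derivative_transform[OF _ const has_vector_derivative_const]) (use t in simp)
    then have "d = 0"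
      using d t \<open>a < b\<close> by (intro vector_derivative_unique_within_closed_interval[of a b t f d 0]) auto
    then show False
      using \<open>d > 0\<close> by simp
  qed
  with mono[of a b] \<open>a < b\<close> show ?thesis
    by simp
qed

section \<open>Smooth functions\<close>

text \<open>Smoothness of sums and products needs a witnessing family closed under partial
  derivatives. By the sum and product rules, closing such a family under both operations keeps this
  property.\<close>

inductive_set function_algebra :: "('a \<Rightarrow> real) set \<Rightarrow> ('a \<Rightarrow> real) set" for F where
  base: "f \<in> F \<Longrightarrow> f \<in> function_algebra F"
| add: "f \<in> function_algebra F \<Longrightarrow> g \<in> function_algebra F \<Longrightarrow> (\<lambda>x. f x + g x) \<in> function_algebra F"
| mult: "f \<in> function_algebra F \<Longrightarrow> g \<in> function_algebra F \<Longrightarrow> (\<lambda>x. f x * g x) \<in> function_algebra F"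

lemma smooth_on_function_algebra:
  fixes F :: "('a::euclidean_space \<Rightarrow> real) set"
  assumes F: "\<forall>h\<in>F. continuous_on S h \<and> (\<forall>i\<in>Basis. \<exists>h'\<in>F. \<forall>x\<in>S.
                ((\<lambda>t. h (x + t *\<^sub>R i)) has_real_derivative h' x) (at 0))"
    and f: "f \<in> function_algebra F"
  shows "smooth_on S f"
proof -
  have "continuous_on S h \<and> (\<forall>i\<in>Basis. \<exists>h'\<in>function_algebra F. \<forall>x\<in>S.
      ((\<lambda>t. h (x + t *\<^sub>R i)) has_real_derivative h' x) (at 0))" if "h \<in> function_algebra F" for h
    using that
  proof induction
    case (base f)
    then show ?case
      using F by (meson function_algebra.base)
  next
    case (add f g)
    have "\<exists>h'\<in>function_algebra F. \<forall>x\<in>S.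
        ((\<lambda>t. f (x + t *\<^sub>R i) + g (x + t *\<^sub>R i)) has_real_derivative h' x) (at 0)" if i: "i \<in> Basis" for i
    proof -
      obtain f' where f': "f' \<in> function_algebra F"
        "\<And>x. x \<in> S \<Longrightarrow> ((\<lambda>t. f (x + t *\<^sub>R i)) has_real_derivative f' x) (at 0)"
        using add.IH(1) i by blast
      obtain g' where g': "g' \<in> function_algebra F"
        "\<And>x. x \<in> S \<Longrightarrow> ((\<lambda>t. g (x + t *\<^sub>R i)) has_real_derivative g' x) (at 0)"
        using add.IH(2) i by blast
      show ?thesis
        using f' g' by (intro bexI[of _ "\<lambda>x. f' x + g' x"] ballI DERIV_add function_algebra.add)
    qed
    then show ?case
      using add.IH by (simp add: continuous_on_add)
  next
    case (mult f g)
    have "\<exists>h'\<in>function_algebra F. \<forall>x\<in>S.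
        ((\<lambda>t. f (x + t *\<^sub>R i) * g (x + t *\<^sub>R i)) has_real_derivative h' x) (at 0)" if i: "i \<in> Basis" for i
    proof -
      obtain f' where f': "f' \<in> function_algebra F"
        "\<And>x. x \<in> S \<Longrightarrow> ((\<lambda>t. f (x + t *\<^sub>R i)) has_real_derivative f' x) (at 0)"
        using mult.IH(1) i by blast
      obtain g' where g': "g' \<in> function_algebra F"
        "\<And>x. x \<in> S \<Longrightarrow> ((\<lambda>t. g (x + t *\<^sub>R i)) has_real_derivative g' x) (at 0)"
        using mult.IH(2) i by blast
      have "((\<lambda>t. f (x + t *\<^sub>R i) * g (x + t *\<^sub>R i)) has_real_derivative f' x * g x + g' x * f x) (at 0)"
        if "x \<in> S" for x
        using DERIV_mult[OF f'(2)[OF that] g'(2)[OF that]] by simp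
      then show ?thesis
        using f' g' mult.hyps
        by (intro bexI[of _ "\<lambda>x. f' x * g x + g' x * f x"] ballI function_algebra.intros(2,3))
    qed
    then show ?case
      using mult.IH by (simp add: continuous_on_mult)
  qed
  then show ?thesis
    unfolding smooth_on_def using f by blast
qed

lemma smooth_on_add_mult:
  assumes f: "smooth_on S f" and g: "smooth_on S g"
  shows smooth_on_add: "smooth_on S (\<lambda>x. f x + g x)"
    and smooth_on_mult: "smooth_on S (\<lambda>x. f x * g x)"
proof -
  from f g obtain F G where "f \<in> F" "g \<in> G"
    and F: "\<forall>h\<in>F. continuous_on S h \<and> (\<forall>i\<in>Basis. \<exists>h'\<in>F. \<forall>x\<in>S.
                ((\<lambda>t. h (x + t *\<^sub>R i)) has_real_derivative h' x) (at 0))"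
    and G: "\<forall>h\<in>G. continuous_on S h \<and> (\<forall>i\<in>Basis. \<exists>h'\<in>G. \<forall>x\<in>S.
                ((\<lambda>t. h (x + t *\<^sub>R i)) has_real_derivative h' x) (at 0))"
    unfolding smooth_on_def by (elim exE conjE) (rule that)
  \<comment> \<open>The two witnessing families are merged: each member still finds its partial
    derivatives in the family it came from.\<close>
  have FG: "\<forall>h\<in>F \<union> G. continuous_on S h \<and> (\<forall>i\<in>Basis. \<exists>h'\<in>F \<union> G. \<forall>x\<in>S.
                ((\<lambda>t. h (x + t *\<^sub>R i)) has_real_derivative h' x) (at 0))"
  proof (intro ballI conjI)
    fix h and i :: 'a assume h: "h \<in> F \<union> G" and i: "i \<in> Basis"
    show "\<exists>h'\<in>F \<union> G. \<forall>x\<in>S. ((\<lambda>t. h (x + t *\<^sub>R i)) has_real_derivative h' x) (at 0)"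
      using h F[rule_format, of h] G[rule_format, of h] i by (elim UnE) (metis UnI1, metis UnI2)
  qed (use F G in blast)
  have "f \<in> function_algebra (F \<union> G)" "g \<in> function_algebra (F \<union> G)"
    using \<open>f \<in> F\<close> \<open>g \<in> G\<close> by (simp_all add: function_algebra.base)
  note fg = this
  show "smooth_on S (\<lambda>x. f x + g x)"
    by (rule smooth_on_function_algebra[OF FG function_algebra.add[OF fg]])
  show "smooth_on S (\<lambda>x. f x * g x)"
    by (rule smooth_on_function_algebra[OF FG function_algebra.mult[OF fg]])
qed

lemma smooth_on_const: "smooth_on S (\<lambda>_. c)"
  unfolding smooth_on_def
  by (intro exI[of _ "range (\<lambda>c _. c)"]) (auto intro!: exI[of _ 0])

lemma smooth_on_inner: "smooth_on S (\<lambda>x. x \<bullet> b)"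
  unfolding smooth_on_def
proof (intro exI[of _ "insert (\<lambda>x. x \<bullet> b) (range (\<lambda>c _. c))"] conjI ballI)
  fix h :: "'a \<Rightarrow> real" and i :: 'a
  assume h: "h \<in> insert (\<lambda>x. x \<bullet> b) (range (\<lambda>c _. c))"
  show "continuous_on S h"
    using h by (auto intro!: continuous_intros)
  show "\<exists>h'\<in>insert (\<lambda>x. x \<bullet> b) (range (\<lambda>c _. c)).
         \<forall>x\<in>S. ((\<lambda>t. h (x + t *\<^sub>R i)) has_real_derivative h' x) (at 0)"
  proof (cases "h = (\<lambda>x. x \<bullet> b)")
    case True
    have "((\<lambda>t. x \<bullet> b + t * (i \<bullet> b)) has_real_derivative i \<bullet> b) (at 0)" for x
      by (auto intro!: derivative_eq_intros)
    then show ?thesis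
      using True by (intro bexI[of _ "\<lambda>_. i \<bullet> b"]) (auto simp: inner_add_left)
  next
    case False
    then show ?thesis
      using h by (intro bexI[of _ "\<lambda>_. 0"]) auto
  qed
qed simp

lemma smooth_on_vec_nth: "smooth_on S (\<lambda>x::real^'n. x $ k)"
  using smooth_on_inner[of S "axis k 1"] by (simp add: inner_axis)

lemmas smooth_on_intros = smooth_on_const smooth_on_vec_nth smooth_on_add smooth_on_mult

lemma smooth_field_vec_iff: "smooth_field S X \<longleftrightarrow> (\<forall>k. smooth_on S (\<lambda>q. X q $ k))"
  for X :: "real^'n \<Rightarrow> real^'n"
  by (auto simp: smooth_field_def Basis_vec_def inner_axis)

section \<open>The sub-space-time\<close>

definition pt :: "real \<Rightarrow> real \<Rightarrow> real \<Rightarrow> real^3" where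
  "pt x y z = x *\<^sub>R axis 1 1 + y *\<^sub>R axis 2 1 + z *\<^sub>R axis 3 1"

lemma pt_nth [simp]: "pt x y z $ 1 = x" "pt x y z $ 2 = y" "pt x y z $ 3 = z"
  by (simp_all add: pt_def axis_def)

lemma pt_eq_iff: "p = q \<longleftrightarrow> p $ 1 = q $ 1 \<and> p $ 2 = q $ 2 \<and> p $ 3 = q $ 3" for p q :: "real^3"
  by (simp add: vec_eq_iff forall_3)

definition frame_u :: "real^3 \<Rightarrow> real^3" where "frame_u p = pt 1 0 ((p $ 1 - p $ 2)\<^sup>2)"
definition frame_v :: "real^3 \<Rightarrow> real^3" where "frame_v p = pt 0 1 0"
definition mart_D :: "real^3 \<Rightarrow> (real^3) set" where "mart_D p = {w. w $ 3 = (p $ 1 - p $ 2)\<^sup>2 * w $ 1}"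
text \<open>Written in null coordinates: both frame fields are null and their mutual product is -1.
  The coordinates 1 and 2 parametrise the plane \<open>mart_D p\<close>, on which the form is a
  Lorentzian plane metric.\<close>

definition mart_g :: "real^3 \<Rightarrow> real^3 \<Rightarrow> real^3 \<Rightarrow> real" where "mart_g p v w = - (v $ 1 * w $ 2 + v $ 2 * w $ 1)"
text \<open>The sum of the two null frame fields, so that \<open>mart_g p (mart_T p) w\<close> is
  \<open>- (w $ 1 + w $ 2)\<close>.\<close>

definition mart_T :: "real^3 \<Rightarrow> real^3" where "mart_T p = pt 1 1 ((p $ 1 - p $ 2)\<^sup>2)"

lemma smooth_on_sq: "smooth_on S (\<lambda>p::real^3. (p $ 1 - p $ 2)\<^sup>2)"
proof -
  have "smooth_on S (\<lambda>p::real^3. (p $ 1 + (- 1) * p $ 2) * (p $ 1 + (- 1) * p $ 2))"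
    by (intro smooth_on_intros)
  then show ?thesis
    by (simp add: power2_eq_square)
qed

lemma smooth_field_frame: "smooth_field S frame_u" "smooth_field S frame_v" "smooth_field S mart_T"
  by (auto simp: smooth_field_vec_iff forall_3 frame_u_def frame_v_def mart_T_def smooth_on_const smooth_on_sq)

lemma subspace_mart_D: "subspace (mart_D p)"
  by (auto simp: subspace_def mart_D_def algebra_simps)

lemma span_frame: "span {frame_u p, frame_v p} = mart_D p"
proof
  show "span {frame_u p, frame_v p} \<subseteq> mart_D p"
    by (rule span_minimal) (auto simp: subspace_mart_D, auto simp: mart_D_def frame_u_def frame_v_def)
  show "mart_D p \<subseteq> span {frame_u p, frame_v p}"
  proof
    fix w assume "w \<in> mart_D p"
    then have "w = w $ 1 *\<^sub>R frame_u p + w $ 2 *\<^sub>R frame_v p"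
      by (simp add: pt_eq_iff mart_D_def frame_u_def frame_v_def)
    moreover have "w $ 1 *\<^sub>R frame_u p + w $ 2 *\<^sub>R frame_v p \<in> span {frame_u p, frame_v p}"
      by (intro span_add span_mul span_base) auto
    ultimately show "w \<in> span {frame_u p, frame_v p}"
      by simp
  qed
qed

lemma dim_mart_D: "dim (mart_D p) = 2"
proof -
  have ne: "frame_u p \<noteq> frame_v p"
    by (auto simp: frame_u_def frame_v_def pt_eq_iff)
  have "independent {frame_u p, frame_v p}"
  proof (rule independent_insertI)
    show "frame_u p \<notin> span {frame_v p}"
      by (auto simp: span_singleton frame_u_def frame_v_def pt_eq_iff)
    show "independent {frame_v p}"
      by (auto simp: frame_v_def pt_eq_iff)
  qed
  then show ?thesis
    using ne dim_span_eq_card_independent[of "{frame_u p, frame_v p}"] by (simp add: span_frame)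
qed

lemma smooth_distribution_mart_D: "smooth_distribution UNIV mart_D 2"
proof -
  define X where "X i = (if i = 0 then frame_u else frame_v)" for i :: nat
  have im: "(\<lambda>i. X i q) ` {..<2} = {frame_u q, frame_v q}" for q
    by (auto simp: X_def numeral_2_eq_2 lessThan_Suc)
  have "\<forall>i<2. smooth_field UNIV (X i)"
    by (auto simp: X_def smooth_field_frame)
  then show ?thesis
    unfolding smooth_distribution_def
    using im span_frame by (auto simp: subspace_mart_D dim_mart_D intro!: exI[of _ UNIV] exI[of _ X])
qed

section \<open>Bracket generation and the metric\<close>

lemma lie_bracket_frame_u_frame_v: "lie_bracket frame_u frame_v = (\<lambda>p. pt 0 0 (2 * (p $ 1 - p $ 2)))"
proof
  fix p :: "real^3"
  have "((\<lambda>t. pt 1 0 ((p $ 1 - (p $ 2 + t))\<^sup>2)) has_vector_derivative pt 0 0 (- 2 * (p $ 1 - p $ 2))) (at 0)"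
    unfolding pt_def by (auto intro!: derivative_eq_intros simp: algebra_simps)
  then have "((\<lambda>t. frame_u (p + t *\<^sub>R frame_v p)) has_vector_derivative pt 0 0 (- 2 * (p $ 1 - p $ 2))) (at 0)"
    by (simp add: frame_u_def frame_v_def)
  from vector_derivative_at[OF this]
  show "lie_bracket frame_u frame_v p = pt 0 0 (2 * (p $ 1 - p $ 2))"
    by (simp add: lie_bracket_def frame_v_def[abs_def] pt_eq_iff)
qed

text \<open>The first bracket vanishes on the surface where the first two coordinates agree, and
  cannot complete the frame there. One more derivative along \<open>frame_v\<close> gives a vertical
  field without zeros.\<close>

lemma lie_bracket_frame_v_frame_u_frame_v: "lie_bracket frame_v (lie_bracket frame_u frame_v) = (\<lambda>p. pt 0 0 (- 2))"
proof
  fix p :: "real^3"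
  have "((\<lambda>t. pt 0 0 (2 * (p $ 1 - (p $ 2 + t)))) has_vector_derivative pt 0 0 (- 2)) (at 0)"
    unfolding pt_def by (auto intro!: derivative_eq_intros simp: algebra_simps)
  then have "((\<lambda>t. lie_bracket frame_u frame_v (p + t *\<^sub>R frame_v p)) has_vector_derivative pt 0 0 (- 2)) (at 0)"
    by (simp add: lie_bracket_frame_u_frame_v frame_v_def)
  note vector_derivative_at[OF this]
  moreover have "vector_derivative (\<lambda>t. frame_v (p + t *\<^sub>R v)) (at 0) = 0" for v
    by (simp add: frame_v_def)
  ultimately show "lie_bracket frame_v (lie_bracket frame_u frame_v) p = pt 0 0 (- 2)"
    unfolding lie_bracket_def[of frame_v "lie_bracket frame_u frame_v"] by simp
qed

lemma bracket_generating_mart_D: "bracket_generating UNIV mart_D"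
  unfolding bracket_generating_def
proof (intro ballI exI[of _ UNIV] conjI)
  fix p :: "real^3"
  have frame_u: "frame_u \<in> lie_fields mart_D UNIV" and frame_v: "frame_v \<in> lie_fields mart_D UNIV"
    by (auto intro!: lie_fields.base simp: horizontal_field_def smooth_field_frame mart_D_def frame_u_def frame_v_def)
  let ?Z = "lie_bracket frame_v (lie_bracket frame_u frame_v)"
  have Z: "?Z \<in> lie_fields mart_D UNIV"
    by (intro lie_fields.bracket frame_u frame_v)
  have "w \<in> span ((\<lambda>X. X p) ` lie_fields mart_D UNIV)" for w
  proof -
    \<comment> \<open>Since the second bracket is \<open>pt 0 0 (- 2)\<close>, its coefficient is
      minus one half of the height by which \<open>w\<close> misses the plane
      \<open>mart_D p\<close>.\<close>
    have "w = w $ 1 *\<^sub>R frame_u p + w $ 2 *\<^sub>R frame_v p + (((p $ 1 - p $ 2)\<^sup>2 * w $ 1 - w $ 3) / 2) *\<^sub>R ?Z p"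
      by (simp add: lie_bracket_frame_v_frame_u_frame_v pt_eq_iff frame_u_def frame_v_def field_simps)
    also have "\<dots> \<in> span ((\<lambda>X. X p) ` lie_fields mart_D UNIV)"
      using frame_u frame_v Z by (intro span_add span_mul span_base) auto
    finally show ?thesis .
  qed
  then show "span ((\<lambda>X. X p) ` lie_fields mart_D UNIV) = UNIV"
    by blast
qed auto

lemma sub_lorentzian_metric_mart_g: "sub_lorentzian_metric UNIV mart_D mart_g"
  unfolding sub_lorentzian_metric_def
proof (intro conjI ballI allI impI)
  fix p u v w :: "real^3" and a b :: real
  show "mart_g p u v = mart_g p v u"
    by (simp add: mart_g_def algebra_simps)
  show "mart_g p (a *\<^sub>R u + b *\<^sub>R v) w = a * mart_g p u w + b * mart_g p v w"
    by (simp add: mart_g_def algebra_simps)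
  show "v = 0" if "v \<in> mart_D p" "\<forall>w\<in>mart_D p. mart_g p v w = 0"
  proof -
    \<comment> \<open>Pairing with \<open>frame_u\<close> reads off minus the second component of
      \<open>v\<close>, pairing with \<open>frame_v\<close> minus the first; the third follows from
      \<open>v \<in> mart_D p\<close>.\<close>
    have "mart_g p v (frame_u p) = 0" "mart_g p v (frame_v p) = 0"
      using that by (auto simp: mart_D_def frame_u_def frame_v_def)
    then show "v = 0"
      using that(1) by (simp add: mart_g_def frame_u_def frame_v_def mart_D_def pt_eq_iff)
  qed
  show "\<exists>v\<in>mart_D p. mart_g p v v < 0"
    by (intro bexI[of _ "mart_T p"]) (auto simp: mart_D_def mart_T_def mart_g_def)
  fix W :: "(real^3) set"
  assume W: "subspace W \<and> W \<subseteq> mart_D p \<and> (\<forall>w\<in>W. w \<noteq> 0 \<longrightarrow> mart_g p w w < 0)"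
  \<comment> \<open>A vector whose first component is 0 is null, so no nonzero one lies in a
    negative definite \<open>W\<close>. The first component therefore embeds \<open>W\<close>
    linearly into the reals.\<close>
  have "inj_on (\<lambda>w. w $ 1) W"
  proof (rule inj_onI, rule ccontr)
    fix x y assume xy: "x \<in> W" "y \<in> W" "x $ 1 = y $ 1" "x \<noteq> y"
    then have "x - y \<in> W" "x - y \<noteq> 0"
      using W by (auto intro: subspace_diff)
    then have "mart_g p (x - y) (x - y) < 0"
      using W by blast
    then show False
      using xy(3) by (simp add: mart_g_def)
  qed
  then have "inj_on (\<lambda>w. w $ 1) (span W)"
    using W by (simp add: span_eq_iff[THEN iffD2])
  moreover have "linear (\<lambda>w::real^3. w $ 1)"
    by (intro linearI) auto
  ultimately have "dim W = dim ((\<lambda>w. w $ 1) ` W)"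
    by (metis dim_image_eq)
  also have "\<dots> \<le> 1"
    using dim_subset_UNIV[of "(\<lambda>w. w $ 1) ` W"] by simp
  finally show "dim W \<le> 1" .
next
  fix U and X Y :: "real^3 \<Rightarrow> real^3"
  assume "open U \<and> U \<subseteq> UNIV \<and> horizontal_field mart_D U X \<and> horizontal_field mart_D U Y"
  then have "smooth_on U (\<lambda>q. X q $ k)" "smooth_on U (\<lambda>q. Y q $ k)" for k
    by (auto simp: horizontal_field_def smooth_field_vec_iff)
  then have "smooth_on U (\<lambda>q. (- 1) * (X q $ 1 * Y q $ 2 + X q $ 2 * Y q $ 1))"
    by (intro smooth_on_intros)
  then show "smooth_on U (\<lambda>q. mart_g q (X q) (Y q))"
    by (simp add: mart_g_def)
qed

lemma sub_space_time_mart: "sub_space_time UNIV mart_D mart_g mart_T 2"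
  unfolding sub_space_time_def
  using smooth_distribution_mart_D bracket_generating_mart_D sub_lorentzian_metric_mart_g
  by (auto simp: horizontal_field_def smooth_field_frame mart_D_def mart_T_def mart_g_def)

section \<open>Causal curves\<close>

text \<open>For a velocity \<open>w\<close>, the form gives \<open>- 2 * w $ 1 * w $ 2\<close> on
  \<open>w\<close> itself and \<open>- (w $ 1 + w $ 2)\<close> against \<open>mart_T\<close>.
  Negativity of the first gives both components the same sign, negativity of the second makes it
  positive.\<close>

lemma timelike_fdE:
  assumes "timelike_fd UNIV mart_D mart_g mart_T \<gamma> \<gamma>'"
  obtains N where "negligible N" "\<And>t. t \<in> {0..1} \<Longrightarrow> t \<notin> N \<Longrightarrow>
    (\<gamma> has_vector_derivative \<gamma>' t) (at t within {0..1}) \<and> \<gamma>' t \<in> mart_D (\<gamma> t) \<and> \<gamma>' t $ 1 > 0 \<and> \<gamma>' t $ 2 > 0"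
proof -
  have "AE t in lebesgue_on {0..1}. (\<gamma> has_vector_derivative \<gamma>' t) (at t within {0..1}) \<and> \<gamma>' t \<in> mart_D (\<gamma> t)"
    and "AE t in lebesgue_on {0..1}. mart_g (\<gamma> t) (\<gamma>' t) (\<gamma>' t) < 0 \<and> mart_g (\<gamma> t) (mart_T (\<gamma> t)) (\<gamma>' t) < 0"
    using assms by (auto simp: timelike_fd_def horizontal_curve_def)
  then have "AE t in lebesgue_on {0..1}. (\<gamma> has_vector_derivative \<gamma>' t) (at t within {0..1}) \<and>
      \<gamma>' t \<in> mart_D (\<gamma> t) \<and> \<gamma>' t $ 1 > 0 \<and> \<gamma>' t $ 2 > 0"
    by eventually_elim (auto simp: mart_g_def mart_T_def zero_less_mult_iff)
  then show ?thesis
    by (rule AE_lebesgue_on_E) (use that in auto)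
qed

text \<open>The weak form of the sign computation for timelike velocities. The first component
  governs the third, which on \<open>mart_D\<close> is a square multiple of it.\<close>

lemma nonspacelike_fdE:
  assumes "nonspacelike_fd UNIV mart_D mart_g mart_T \<gamma> \<gamma>'"
  obtains N where "negligible N" "\<And>t. t \<in> {0..1} \<Longrightarrow> t \<notin> N \<Longrightarrow>
    (\<gamma> has_vector_derivative \<gamma>' t) (at t within {0..1}) \<and> \<gamma>' t \<in> mart_D (\<gamma> t) \<and> \<gamma>' t $ 1 \<ge> 0"
proof -
  have "AE t in lebesgue_on {0..1}. (\<gamma> has_vector_derivative \<gamma>' t) (at t within {0..1}) \<and> \<gamma>' t \<in> mart_D (\<gamma> t)"
    and "AE t in lebesgue_on {0..1}. mart_g (\<gamma> t) (\<gamma>' t) (\<gamma>' t) \<le> 0 \<and> \<gamma>' t \<noteq> 0 \<and> mart_g (\<gamma> t) (mart_T (\<gamma> t)) (\<gamma>' t) < 0"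
    using assms by (auto simp: nonspacelike_fd_def horizontal_curve_def)
  then have "AE t in lebesgue_on {0..1}. (\<gamma> has_vector_derivative \<gamma>' t) (at t within {0..1}) \<and>
      \<gamma>' t \<in> mart_D (\<gamma> t) \<and> \<gamma>' t $ 1 \<ge> 0"
    by eventually_elim (auto simp: mart_g_def mart_T_def zero_le_mult_iff)
  then show ?thesis
    by (rule AE_lebesgue_on_E) (use that in auto)
qed

lemma absolutely_continuous_on_vec_nth:
  fixes \<gamma> :: "real \<Rightarrow> real^'n"
  assumes "absolutely_continuous_on S \<gamma>"
  shows "absolutely_continuous_on S (\<lambda>t. \<gamma> t $ k)"
  by (rule absolutely_continuous_on_lipschitz_compose[OF assms, of "\<lambda>p. p $ k" 1])
     (metis component_le_norm_cart mult_1 real_norm_def vector_minus_component)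

lemma has_vector_derivative_vec_nth:
  "(\<gamma> has_vector_derivative d) F \<Longrightarrow> ((\<lambda>t. \<gamma> t $ k) has_vector_derivative d $ k) F"
  for \<gamma> :: "real \<Rightarrow> real^'n"
  by (rule bounded_linear.has_vector_derivative[OF bounded_linear_vec_nth])

text \<open>Horizontality makes the vertical velocity a square times the first component, hence
  nonnegative almost everywhere. This one-sidedness is what cuts off the points below
  \<open>pt 0 1 0\<close>.\<close>

lemma nonspacelike_mono:
  assumes "nonspacelike_fd UNIV mart_D mart_g mart_T \<gamma> \<gamma>'"
  shows "\<gamma> 0 $ 3 \<le> \<gamma> 1 $ 3"
proof -
  obtain N where "negligible N" and N: "\<And>t. t \<in> {0..1} \<Longrightarrow> t \<notin> N \<Longrightarrow>
    (\<gamma> has_vector_derivative \<gamma>' t) (at t within {0..1}) \<and> \<gamma>' t \<in> mart_D (\<gamma> t) \<and> \<gamma>' t $ 1 \<ge> 0"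
    by (rule nonspacelike_fdE[OF assms]) (rule that)
  have "absolutely_continuous_on {0..1} (\<lambda>t. \<gamma> t $ 3)"
    using assms by (intro absolutely_continuous_on_vec_nth) (simp add: nonspacelike_fd_def horizontal_curve_def)
  then show ?thesis
  proof (rule absolutely_continuous_on_imp_mono[OF _ _ \<open>negligible N\<close>])
    fix t :: real assume "t \<in> {0..1}" "t \<notin> N"
    then have "\<gamma>' t $ 3 \<ge> 0" "((\<lambda>t. \<gamma> t $ 3) has_vector_derivative \<gamma>' t $ 3) (at t within {0..1})"
      using N[of t] has_vector_derivative_vec_nth[of \<gamma> "\<gamma>' t" _ 3] by (auto simp: mart_D_def)
    then show "\<exists>d\<ge>0. ((\<lambda>t. \<gamma> t $ 3) has_vector_derivative d) (at t within {0..1})"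
      by blast
  qed simp
qed

lemma timelike_strict_mono:
  assumes "timelike_fd UNIV mart_D mart_g mart_T \<gamma> \<gamma>'" and "0 \<le> a" "a < b" "b \<le> 1" and k: "k = 1 \<or> k = 2"
  shows "\<gamma> a $ k < \<gamma> b $ k"
proof -
  obtain N where "negligible N" and N: "\<And>t. t \<in> {0..1} \<Longrightarrow> t \<notin> N \<Longrightarrow>
    (\<gamma> has_vector_derivative \<gamma>' t) (at t within {0..1}) \<and> \<gamma>' t \<in> mart_D (\<gamma> t) \<and> \<gamma>' t $ 1 > 0 \<and> \<gamma>' t $ 2 > 0"
    by (rule timelike_fdE[OF assms(1)]) (rule that)
  have sub: "{a..b} \<subseteq> {0..1}"
    using assms by auto
  have "absolutely_continuous_on {0..1} \<gamma>"
    using assms(1) by (simp add: timelike_fd_def horizontal_curve_def)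
  then have "absolutely_continuous_on {a..b} (\<lambda>t. \<gamma> t $ k)"
    by (intro absolutely_continuous_on_vec_nth absolutely_continuous_on_subset[OF _ sub])
  then show ?thesis
  proof (rule absolutely_continuous_on_imp_strict_mono[OF _ \<open>a < b\<close> \<open>negligible N\<close>])
    fix t :: real assume "t \<in> {a..b}" "t \<notin> N"
    then have "(\<gamma> has_vector_derivative \<gamma>' t) (at t within {0..1})" "\<gamma>' t $ k > 0"
      using N[of t] sub k by auto
    then show "\<exists>d>0. ((\<lambda>t. \<gamma> t $ k) has_vector_derivative d) (at t within {a..b})"
      using has_vector_derivative_vec_nth[OF has_vector_derivative_within_subset[OF _ sub]] by blast
  qed
qed

section \<open>Bounds for the height gained by a timelike arc\<close>

lemma cube_diff_bound:
  fixes x y K :: real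
  assumes "\<bar>x\<bar> \<le> K" "\<bar>y\<bar> \<le> K"
  shows "\<bar>x ^ 3 / 3 - y ^ 3 / 3\<bar> \<le> K\<^sup>2 * \<bar>x - y\<bar>"
proof -
  have "K \<ge> 0"
    using assms by linarith
  have "\<bar>x\<^sup>2 + x * y + y\<^sup>2\<bar> \<le> \<bar>x\<bar> * \<bar>x\<bar> + \<bar>x\<bar> * \<bar>y\<bar> + \<bar>y\<bar> * \<bar>y\<bar>"
    unfolding power2_eq_square abs_mult[symmetric] by linarith
  also have "\<dots> \<le> K * K + K * K + K * K"
    using assms \<open>K \<ge> 0\<close> by (intro add_mono mult_mono) auto
  finally have "\<bar>x\<^sup>2 + x * y + y\<^sup>2\<bar> / 3 \<le> K\<^sup>2"
    by (simp add: power2_eq_square)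
  then have "\<bar>x\<^sup>2 + x * y + y\<^sup>2\<bar> / 3 * \<bar>x - y\<bar> \<le> K\<^sup>2 * \<bar>x - y\<bar>"
    by (intro mult_right_mono) auto
  \<comment> \<open>The quadratic factor of a difference of cubes is at most three times the square
    of \<open>K\<close>, so that square is a Lipschitz constant of \<open>x ^ 3 / 3\<close> on
    \<open>{- K..K}\<close>.\<close>
  moreover have "x ^ 3 / 3 - y ^ 3 / 3 = (x\<^sup>2 + x * y + y\<^sup>2) / 3 * (x - y)"
    by (simp add: power2_eq_square power3_eq_cube field_simps)
  ultimately show ?thesis
    by (simp only: abs_mult abs_divide abs_numeral)
qed

text \<open>Write u, v, z for the coordinates along the curve. For constant c, the function z + (c -
  u)^3 / 3 has derivative ((v - u)^2 - (c - u)^2) u'. For c = v(a) it increases and for c = v(b) it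
  decreases, since u \<le> v(a) \<le> v \<le> v(b) on the arc. The bounds are the height gains of
  the null arcs that move u while v is frozen at v(a) or v(b).\<close>

lemma timelike_bounds:
  assumes tl: "timelike_fd UNIV mart_D mart_g mart_T \<gamma> \<gamma>'" and ab: "0 \<le> a" "a < b" "b \<le> 1"
    and le: "\<gamma> b $ 1 \<le> \<gamma> a $ 2"
  shows "(\<gamma> a $ 2 - \<gamma> a $ 1) ^ 3 / 3 - (\<gamma> a $ 2 - \<gamma> b $ 1) ^ 3 / 3 < \<gamma> b $ 3 - \<gamma> a $ 3"
    and "\<gamma> b $ 3 - \<gamma> a $ 3 < (\<gamma> b $ 2 - \<gamma> a $ 1) ^ 3 / 3 - (\<gamma> b $ 2 - \<gamma> b $ 1) ^ 3 / 3"
proof -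
  obtain N where "negligible N" and N: "\<And>t. t \<in> {0..1} \<Longrightarrow> t \<notin> N \<Longrightarrow>
    (\<gamma> has_vector_derivative \<gamma>' t) (at t within {0..1}) \<and> \<gamma>' t \<in> mart_D (\<gamma> t) \<and> \<gamma>' t $ 1 > 0 \<and> \<gamma>' t $ 2 > 0"
    by (rule timelike_fdE[OF tl]) (rule that)
  have sub: "{a..b} \<subseteq> {0..1}"
    using ab by auto
  have ac: "absolutely_continuous_on {a..b} \<gamma>"
    using tl by (intro absolutely_continuous_on_subset[OF _ sub]) (simp add: timelike_fd_def horizontal_curve_def)
  have mono: "\<gamma> s $ k \<le> \<gamma> t $ k" if "a \<le> s" "s \<le> t" "t \<le> b" "k = 1 \<or> k = 2" for s t k
    using timelike_strict_mono[OF tl, of s t k] that ab by (cases "s = t") auto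
  define f where "f c t = \<gamma> t $ 3 + (c - \<gamma> t $ 1) ^ 3 / 3" for c t
  have acf: "absolutely_continuous_on {a..b} (f c)" for c
  proof -
    \<comment> \<open>The first coordinate is monotone, so its distance from \<open>c\<close> is
      controlled by the distances at the two endpoints.\<close>
    define K where "K = \<bar>c - \<gamma> a $ 1\<bar> + \<bar>c - \<gamma> b $ 1\<bar>"
    have K: "\<bar>c - \<gamma> t $ 1\<bar> \<le> K" if "t \<in> {a..b}" for t
      using mono[of a t 1] mono[of t b 1] that by (auto simp: K_def)
    have "norm (((c - \<gamma> s $ 1) ^ 3 / 3) - ((c - \<gamma> t $ 1) ^ 3 / 3)) \<le> K\<^sup>2 * norm (\<gamma> s $ 1 - \<gamma> t $ 1)"
      if "s \<in> {a..b}" "t \<in> {a..b}" for s t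
      using cube_diff_bound[OF K[OF that(1)] K[OF that(2)]] by (simp add: abs_minus_commute)
    then have "absolutely_continuous_on {a..b} (\<lambda>t. (c - \<gamma> t $ 1) ^ 3 / 3)"
      by (rule absolutely_continuous_on_lipschitz_compose[OF absolutely_continuous_on_vec_nth[OF ac, of 1], of "\<lambda>x. (c - x) ^ 3 / 3"])
    then show ?thesis
      unfolding f_def by (intro absolutely_continuous_on_add absolutely_continuous_on_vec_nth[OF ac])
  qed
  have deriv: "(f c has_vector_derivative ((\<gamma> t $ 2 - \<gamma> t $ 1)\<^sup>2 - (c - \<gamma> t $ 1)\<^sup>2) * \<gamma>' t $ 1) (at t within {a..b})"
    if "t \<in> {a..b}" "t \<notin> N" for c t
  proof -
    have *: "(\<gamma> has_vector_derivative \<gamma>' t) (at t within {a..b})" "\<gamma>' t $ 3 = (\<gamma> t $ 1 - \<gamma> t $ 2)\<^sup>2 * \<gamma>' t $ 1"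
      using N[of t] that sub by (auto simp: mart_D_def intro: has_vector_derivative_within_subset[OF _ sub])
    have "((\<lambda>t. \<gamma> t $ k) has_real_derivative \<gamma>' t $ k) (at t within {a..b})" for k
      using has_vector_derivative_vec_nth[OF *(1), of k] by (simp add: has_real_derivative_iff_has_vector_derivative)
    note [derivative_intros] = this
    have "(f c has_real_derivative \<gamma>' t $ 3 - (c - \<gamma> t $ 1)\<^sup>2 * \<gamma>' t $ 1) (at t within {a..b})"
      unfolding f_def by (auto intro!: derivative_eq_intros)
    then show ?thesis
      unfolding * by (simp add: has_real_derivative_iff_has_vector_derivative algebra_simps power2_commute)
  qed
  \<comment> \<open>The endpoints join the exceptional set: v = v(a) at \<open>a\<close> and v =
    v(b) at \<open>b\<close>, so the corresponding difference of squares vanishes there.\<close>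
  have Nab: "negligible (N \<union> {a, b})"
    using \<open>negligible N\<close> by (simp add: negligible_Un)
  have "f (\<gamma> a $ 2) a < f (\<gamma> a $ 2) b"
  proof (rule absolutely_continuous_on_imp_strict_mono[OF acf \<open>a < b\<close> Nab])
    fix t assume t: "t \<in> {a..b}" "t \<notin> N \<union> {a, b}"
    have "\<gamma> t $ 1 \<le> \<gamma> a $ 2" "\<gamma> a $ 2 < \<gamma> t $ 2"
      using mono[of t b 1] timelike_strict_mono[OF tl, of a t 2] t ab le by auto
    then have "(\<gamma> a $ 2 - \<gamma> t $ 1)\<^sup>2 < (\<gamma> t $ 2 - \<gamma> t $ 1)\<^sup>2"
      by (intro power_strict_mono) auto
    moreover have "\<gamma>' t $ 1 > 0"
      using N[of t] t sub by auto
    ultimately show "\<exists>d>0. (f (\<gamma> a $ 2) has_vector_derivative d) (at t within {a..b})"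
      using t by (intro exI conjI, rule_tac [2] deriv) auto
  qed
  then show "(\<gamma> a $ 2 - \<gamma> a $ 1) ^ 3 / 3 - (\<gamma> a $ 2 - \<gamma> b $ 1) ^ 3 / 3 < \<gamma> b $ 3 - \<gamma> a $ 3"
    by (simp add: f_def)
  have "- f (\<gamma> b $ 2) a < - f (\<gamma> b $ 2) b"
  proof (rule absolutely_continuous_on_imp_strict_mono[OF _ \<open>a < b\<close> Nab])
    show "absolutely_continuous_on {a..b} (\<lambda>t. - f (\<gamma> b $ 2) t)"
      by (rule absolutely_continuous_on_lipschitz_compose[OF acf, where h = uminus and C = 1]) (simp add: abs_minus_commute)
    fix t assume t: "t \<in> {a..b}" "t \<notin> N \<union> {a, b}"
    have "\<gamma> t $ 1 \<le> \<gamma> t $ 2" "\<gamma> t $ 2 < \<gamma> b $ 2"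
      using mono[of t b 1] mono[of a t 2] timelike_strict_mono[OF tl, of t b 2] t ab le by auto
    then have "(\<gamma> t $ 2 - \<gamma> t $ 1)\<^sup>2 < (\<gamma> b $ 2 - \<gamma> t $ 1)\<^sup>2"
      by (intro power_strict_mono) auto
    moreover have "\<gamma>' t $ 1 > 0"
      using N[of t] t sub by auto
    ultimately show "\<exists>d>0. ((\<lambda>t. - f (\<gamma> b $ 2) t) has_vector_derivative d) (at t within {a..b})"
      using t by (intro exI conjI, rule_tac [2] has_vector_derivative_minus, rule_tac [2] deriv)
        (auto simp: mult_less_0_iff)
  qed
  then show "\<gamma> b $ 3 - \<gamma> a $ 3 < (\<gamma> b $ 2 - \<gamma> a $ 1) ^ 3 / 3 - (\<gamma> b $ 2 - \<gamma> b $ 1) ^ 3 / 3"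
    by (simp add: f_def)
qed

section \<open>Timelike arcs with prescribed height gain\<close>

lemma has_integral_affine_power:
  fixes c s :: real
  assumes "s \<noteq> 0"
  shows "((\<lambda>t. (c + s * t) ^ m) has_integral ((c + s) ^ Suc m - c ^ Suc m) / (s * (real m + 1))) {0..1}"
proof -
  let ?P = "\<lambda>t. (c + s * t) ^ Suc m * inverse (s * (real m + 1))"
  have "((\<lambda>t. (c + s * t) ^ m) has_integral ?P 1 - ?P 0) {0..1}"
  proof (rule fundamental_theorem_of_calculus)
    fix t :: real
    have "(?P has_real_derivative (c + s * t) ^ m * (s * (real m + 1)) * inverse (s * (real m + 1))) (at t within {0..1})"
      by (auto intro!: derivative_eq_intros simp del: power_Suc)
    also have "(c + s * t) ^ m * (s * (real m + 1)) * inverse (s * (real m + 1)) = (c + s * t) ^ m"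
    proof -
      have "s * (real m + 1) \<noteq> 0"
        using assms by (simp add: add_nonneg_eq_0_iff)
      then show ?thesis
        by (simp only: mult.assoc[of "(c + s * t) ^ m"] right_inverse mult_1_right not_False_eq_True)
    qed
    finally show "(?P has_vector_derivative (c + s * t) ^ m) (at t within {0..1})"
      by (simp add: has_real_derivative_iff_has_vector_derivative)
  qed simp
  then show ?thesis
    by (simp add: divide_inverse algebra_simps)
qed

text \<open>The curve has affine \<open>u\<close> and \<open>v = v\<^sub>0 + V g\<close>, where \<open>g\<close> interpolates between
  \<open>t\<^sup>n\<^sup>+\<^sup>1\<close> (close to the lower null arc) and \<open>1 - (1 - t)\<^sup>n\<^sup>+\<^sup>1\<close> (close to the upper one); the
  interpolation parameter is found by the intermediate value theorem.\<close>

lemma connecting_curve: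
  fixes p q :: "real^3"
  assumes u: "p $ 1 < q $ 1" and v: "p $ 2 < q $ 2" and le: "q $ 1 \<le> p $ 2"
    and lower: "(p $ 2 - p $ 1) ^ 3 / 3 - (p $ 2 - q $ 1) ^ 3 / 3 < q $ 3 - p $ 3"
    and upper: "q $ 3 - p $ 3 < (q $ 2 - p $ 1) ^ 3 / 3 - (q $ 2 - q $ 1) ^ 3 / 3"
  obtains \<delta> \<delta>' where "\<delta> 0 = p" "\<delta> 1 = q" "continuous_on {0..1} \<delta>'"
    "\<And>t. t \<in> {0..1} \<Longrightarrow> (\<delta> has_vector_derivative \<delta>' t) (at t within {0..1}) \<and> \<delta>' t \<in> mart_D (\<delta> t)"
    "\<And>t. 0 < t \<Longrightarrow> t < 1 \<Longrightarrow> \<delta>' t $ 1 > 0 \<and> \<delta>' t $ 2 > 0"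
proof -
  define U where "U = q $ 1 - p $ 1"
  define V where "V = q $ 2 - p $ 2"
  define A where "A = q $ 3 - p $ 3"
  define x where "x = p $ 2 - p $ 1"
  have "U > 0" "V > 0" "x \<ge> U"
    using u v le by (auto simp: U_def V_def x_def)
  \<comment> \<open>\<open>X t\<close> is the gap v - u when v stays at its initial value, and
    \<open>X t + V\<close> the gap when v is already at its final value. \<open>Low\<close> and
    \<open>Upp\<close> are \<open>U\<close> times the integrals of their squares.\<close>
  define X where "X t = x - t * U" for t
  have X: "0 \<le> X t" "X t \<le> x" if "t \<in> {0..1}" for t
  proof -
    have "t * U \<le> 1 * U" "0 \<le> t * U"
      using that \<open>U > 0\<close> by (auto intro: mult_right_mono)
    then show "0 \<le> X t" "X t \<le> x"
      using \<open>x \<ge> U\<close> by (auto simp: X_def)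
  qed
  define Low where "Low = (x ^ 3 - (x - U) ^ 3) / 3"
  define Upp where "Upp = ((x + V) ^ 3 - (x + V - U) ^ 3) / 3"
  have LU: "Low < A" "A < Upp"
    using lower upper by (simp_all add: Low_def Upp_def A_def x_def U_def V_def diff_divide_distrib)
  \<comment> \<open>\<open>C\<close> serves both ends: for \<open>s\<close> in
    \<open>{0..1}\<close>, raising the gap from \<open>X t\<close> to \<open>X t + V * s\<close>, or
    lowering it from \<open>X t + V\<close> to \<open>X t + V - V * s\<close>, changes its square by
    at most \<open>C * s\<close>.\<close>
  define C where "C = V * (2 * (x + V) + V)"
  have "C > 0"
    using \<open>U > 0\<close> \<open>V > 0\<close> \<open>x \<ge> U\<close> by (simp add: C_def)
  \<comment> \<open>The extreme profiles miss the null arcs by at most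
    \<open>U * C / (real n + 2)\<close> in height, because \<open>t ^ Suc n\<close> has integral
    \<open>1 / (real n + 2)\<close>. The slightly larger bound with \<open>real n + 1\<close> is
    made smaller than both margins around \<open>A\<close>.\<close>
  obtain n :: nat where n: "U * C / (real n + 1) < min (A - Low) (Upp - A)"
  proof -
    define m where "m = min (A - Low) (Upp - A)"
    have "m > 0"
      using LU by (simp add: m_def)
    obtain n :: nat where "U * C / m < real n"
      using reals_Archimedean2 by blast
    then have "U * C / (real n + 1) < m"
      using \<open>m > 0\<close> by (simp add: field_simps)
    then show ?thesis
      using that by (simp add: m_def)
  qed
  define g where "g \<theta> t = (1 - \<theta>) * t ^ Suc n + \<theta> * (1 - (1 - t) ^ Suc n)" for \<theta> t :: real
  define g' where "g' \<theta> t = (1 - \<theta>) * ((real n + 1) * t ^ n) + \<theta> * ((real n + 1) * (1 - t) ^ n)" for \<theta> t :: real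
  have g_deriv: "(g \<theta> has_real_derivative g' \<theta> t) (at t within S)" for \<theta> t S
    unfolding g_def g'_def
    by (rule derivative_eq_intros refl | simp add: algebra_simps del: power_Suc)+
  define w where "w \<theta> t = X t + V * g \<theta> t" for \<theta> t
  have w_cont: "continuous_on S (w \<theta>)" for S \<theta>
    unfolding w_def X_def g_def by (intro continuous_intros)
  \<comment> \<open>\<open>F \<theta>\<close> is the height gained by the horizontal curve with
    profile \<open>g \<theta>\<close>, as its vertical velocity must be \<open>U\<close> times the
    squared gap.\<close>
  define F where "F \<theta> = U * integral {0..1} (\<lambda>t. (w \<theta> t)\<^sup>2)" for \<theta>
  have F_cont: "continuous_on {0..1} F"
  proof -
    have "continuous_on ({0..1} \<times> cbox 0 1) (\<lambda>(\<theta>, t). (w \<theta> t)\<^sup>2)"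
      unfolding w_def X_def g_def split_beta by (intro continuous_intros)
    from integral_continuous_on_param[OF this] show ?thesis
      unfolding F_def by (intro continuous_intros) simp
  qed
  \<comment> \<open>For \<theta> = 0 the second coordinate rises late, and the squared gap exceeds
    that of the lower null arc by at most \<open>C * t ^ Suc n\<close>.\<close>
  have F0: "F 0 < A"
  proof -
    have "((\<lambda>t. (x + (- U) * t)\<^sup>2 + C * (0 + 1 * t) ^ Suc n) has_integral
        ((x + (- U)) ^ Suc 2 - x ^ Suc 2) / (- U * (real 2 + 1)) +
        C * (((0 + 1) ^ Suc (Suc n) - 0 ^ Suc (Suc n)) / (1 * (real (Suc n) + 1)))) {0..1}"
      using \<open>U > 0\<close> by (intro has_integral_add has_integral_mult_right has_integral_affine_power) auto
    note has = this
    have eq: "((x + (- U)) ^ Suc 2 - x ^ Suc 2) / (- U * (real 2 + 1)) = Low / U"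
      using \<open>U > 0\<close> by (simp add: Low_def field_simps eval_nat_numeral)
    have int: "((\<lambda>t. (X t)\<^sup>2 + C * t ^ Suc n) has_integral Low / U + C / (real n + 2)) {0..1}"
      using has[unfolded eq] by (simp add: X_def mult.commute add.commute)
    have "integral {0..1} (\<lambda>t. (w 0 t)\<^sup>2) \<le> integral {0..1} (\<lambda>t. (X t)\<^sup>2 + C * t ^ Suc n)"
    proof (rule integral_le)
      show "(\<lambda>t. (w 0 t)\<^sup>2) integrable_on {0..1}"
        by (intro integrable_continuous_interval continuous_intros w_cont)
      show "(\<lambda>t. (X t)\<^sup>2 + C * t ^ Suc n) integrable_on {0..1}"
        using int by blast
      fix t :: real assume t: "t \<in> {0..1}"
      define s where "s = t ^ Suc n"
      have s: "0 \<le> s" "s \<le> 1"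
        using t by (auto simp: s_def power_le_one simp del: power_Suc)
      have "(w 0 t)\<^sup>2 = (X t)\<^sup>2 + V * (2 * X t + V * s) * s"
        by (simp add: w_def g_def s_def power2_eq_square algebra_simps)
      also have "\<dots> \<le> (X t)\<^sup>2 + C * s"
      proof -
        have "V * s \<le> V"
          using s \<open>V > 0\<close> by (intro mult_left_le) auto
        then have "2 * X t + V * s \<le> 2 * (x + V) + V"
          using X[OF t] \<open>V > 0\<close> unfolding distrib_left by linarith
        then show ?thesis
          using s \<open>V > 0\<close> by (auto simp: C_def intro!: mult_right_mono mult_left_mono)
      qed
      finally show "(w 0 t)\<^sup>2 \<le> (X t)\<^sup>2 + C * t ^ Suc n"
        by (simp add: s_def)
    qed
    also have "\<dots> = Low / U + C / (real n + 2)"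
      by (rule integral_unique[OF int])
    finally have "F 0 \<le> U * (Low / U + C / (real n + 2))"
      unfolding F_def using \<open>U > 0\<close> by (intro mult_left_mono) auto
    also have "\<dots> = Low + U * C / (real n + 2)"
      using \<open>U > 0\<close> by (simp add: distrib_left)
    also have "\<dots> \<le> Low + U * C / (real n + 1)"
      using \<open>U > 0\<close> \<open>C > 0\<close> by (intro add_left_mono divide_left_mono) auto
    also have "\<dots> < A"
      using n by simp
    finally show ?thesis .
  qed
  \<comment> \<open>For \<theta> = 1 the second coordinate rises early, and the squared gap loses at
    most \<open>C * (1 - t) ^ Suc n\<close> against the upper null arc.\<close>
  have F1: "F 1 > A"
  proof -
    have "((\<lambda>t. (x + V + (- U) * t)\<^sup>2 - C * (1 + (- 1) * t) ^ Suc n) has_integral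
        ((x + V + (- U)) ^ Suc 2 - (x + V) ^ Suc 2) / (- U * (real 2 + 1)) -
        C * (((1 + (- 1)) ^ Suc (Suc n) - 1 ^ Suc (Suc n)) / ((- 1) * (real (Suc n) + 1)))) {0..1}"
      using \<open>U > 0\<close> by (intro has_integral_diff has_integral_mult_right has_integral_affine_power) auto
    note has = this
    have eq: "((x + V + (- U)) ^ Suc 2 - (x + V) ^ Suc 2) / (- U * (real 2 + 1)) = Upp / U"
      using \<open>U > 0\<close> by (simp add: Upp_def field_simps eval_nat_numeral)
    have eq': "((1 + (- 1)) ^ Suc (Suc n) - 1 ^ Suc (Suc n)) / ((- 1) * (real (Suc n) + 1)) = 1 / (real n + 2)"
      by (simp add: field_simps)
    have "(\<lambda>t. (X t + V)\<^sup>2 - C * (1 - t) ^ Suc n) = (\<lambda>t. (x + V + (- U) * t)\<^sup>2 - C * (1 + (- 1) * t) ^ Suc n)"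
      by (simp add: X_def algebra_simps)
    then have int: "((\<lambda>t. (X t + V)\<^sup>2 - C * (1 - t) ^ Suc n) has_integral Upp / U - C / (real n + 2)) {0..1}"
      using has[unfolded eq eq'] by simp
    have "A < Upp - U * C / (real n + 1)"
      using n by simp
    also have "\<dots> \<le> Upp - U * C / (real n + 2)"
      using \<open>U > 0\<close> \<open>C > 0\<close> by (intro diff_left_mono divide_left_mono) auto
    also have "\<dots> = U * (Upp / U - C / (real n + 2))"
      using \<open>U > 0\<close> by (simp add: right_diff_distrib)
    also have "Upp / U - C / (real n + 2) = integral {0..1} (\<lambda>t. (X t + V)\<^sup>2 - C * (1 - t) ^ Suc n)"
      by (rule integral_unique[OF int, symmetric])
    also have "U * \<dots> \<le> U * integral {0..1} (\<lambda>t. (w 1 t)\<^sup>2)"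
    proof (intro mult_left_mono integral_le)
      show "(\<lambda>t. (w 1 t)\<^sup>2) integrable_on {0..1}"
        by (intro integrable_continuous_interval continuous_intros w_cont)
      show "(\<lambda>t. (X t + V)\<^sup>2 - C * (1 - t) ^ Suc n) integrable_on {0..1}"
        using int by blast
      fix t :: real assume t: "t \<in> {0..1}"
      define s where "s = (1 - t) ^ Suc n"
      have s: "0 \<le> s" "s \<le> 1"
        using t by (auto simp: s_def power_le_one simp del: power_Suc)
      have "V * (2 * (X t + V)) \<le> C"
        unfolding C_def using X[OF t] \<open>V > 0\<close> by (intro mult_left_mono) auto
      then have "2 * (X t + V) * V * s \<le> C * s"
        using s by (intro mult_right_mono) (auto simp: mult.commute)
      moreover have "(w 1 t)\<^sup>2 = (X t + V)\<^sup>2 - 2 * (X t + V) * V * s + (V * s)\<^sup>2"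
        by (simp add: w_def g_def s_def power2_eq_square algebra_simps)
      moreover have "(V * s)\<^sup>2 \<ge> 0"
        by simp
      ultimately show "(X t + V)\<^sup>2 - C * (1 - t) ^ Suc n \<le> (w 1 t)\<^sup>2"
        unfolding s_def[symmetric] by linarith
    qed (use \<open>U > 0\<close> in auto)
    finally show ?thesis
      by (simp add: F_def)
  qed
  obtain \<theta> where \<theta>: "0 \<le> \<theta>" "\<theta> \<le> 1" "F \<theta> = A"
    using IVT'[of F 0 A 1] F0 F1 F_cont by auto
  define Z where "Z t = U * integral {0..t} (\<lambda>t. (w \<theta> t)\<^sup>2)" for t
  have Z_deriv: "(Z has_real_derivative U * (w \<theta> t)\<^sup>2) (at t within {0..1})" if "t \<in> {0..1}" for t
    unfolding Z_def
    by (intro DERIV_cmult integral_has_real_derivative that continuous_intros w_cont)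
  define \<delta> where "\<delta> t = pt (p $ 1 + t * U) (p $ 2 + V * g \<theta> t) (p $ 3 + Z t)" for t
  define \<delta>' where "\<delta>' t = pt U (V * g' \<theta> t) (U * (w \<theta> t)\<^sup>2)" for t
  show ?thesis
  proof (rule that)
    show "\<delta> 0 = p"
      by (simp add: \<delta>_def pt_eq_iff g_def Z_def)
    have "Z 1 = A"
      using \<theta>(3) by (simp add: Z_def F_def)
    then show "\<delta> 1 = q"
      by (simp add: \<delta>_def pt_eq_iff g_def U_def V_def A_def)
    show "continuous_on {0..1} \<delta>'"
      unfolding \<delta>'_def pt_def g'_def by (intro continuous_intros w_cont)
    show "(\<delta> has_vector_derivative \<delta>' t) (at t within {0..1}) \<and> \<delta>' t \<in> mart_D (\<delta> t)" if "t \<in> {0..1}" for t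
    proof
      note [derivative_intros] = Z_deriv[OF that] g_deriv
      show "(\<delta> has_vector_derivative \<delta>' t) (at t within {0..1})"
        unfolding \<delta>_def \<delta>'_def pt_def by (auto intro!: derivative_eq_intros)
      have "w \<theta> t = \<delta> t $ 2 - \<delta> t $ 1"
        by (simp add: \<delta>_def w_def X_def x_def)
      then show "\<delta>' t \<in> mart_D (\<delta> t)"
        by (simp add: mart_D_def \<delta>'_def power2_commute)
    qed
    \<comment> \<open>The weights \<open>t ^ n\<close> and \<open>(1 - t) ^ n\<close> may vanish at
      0 and 1, so positivity is claimed on the open interval.\<close>
    show "\<delta>' t $ 1 > 0 \<and> \<delta>' t $ 2 > 0" if "0 < t" "t < 1" for t
    proof -
      have "(real n + 1) * t ^ n > 0" "(real n + 1) * (1 - t) ^ n > 0"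
        using that by auto
      then have "g' \<theta> t > 0"
        unfolding g'_def using \<theta> by (cases "\<theta> = 0") (auto intro!: add_nonneg_pos)
      then show ?thesis
        using \<open>U > 0\<close> \<open>V > 0\<close> by (simp add: \<delta>'_def)
    qed
  qed
qed

section \<open>Splicing in an arc and moving the endpoint vertically\<close>

lemma lipschitz_if_continuous_derivative:
  fixes \<delta> :: "real \<Rightarrow> 'a::real_normed_vector"
  assumes cont: "continuous_on {a..b} \<delta>'"
    and deriv: "\<And>t. t \<in> {a..b} \<Longrightarrow> (\<delta> has_vector_derivative \<delta>' t) (at t within {a..b})"
  obtains K where "K \<ge> 0" "\<And>t. t \<in> {a..b} \<Longrightarrow> norm (\<delta>' t) \<le> K"
    "\<And>x y. x \<in> {a..b} \<Longrightarrow> y \<in> {a..b} \<Longrightarrow> norm (\<delta> x - \<delta> y) \<le> K * \<bar>x - y\<bar>"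
proof -
  have "bounded (\<delta>' ` {a..b})"
    using cont compact_continuous_image compact_imp_bounded by blast
  then obtain K where K: "K > 0" "\<And>t. t \<in> {a..b} \<Longrightarrow> norm (\<delta>' t) \<le> K"
    unfolding bounded_pos by blast
  have "norm (\<delta> x - \<delta> y) \<le> K * \<bar>x - y\<bar>" if "x \<in> {a..b}" "y \<in> {a..b}" for x y
  proof -
    have "norm (\<delta> x - \<delta> y) \<le> K * norm (x - y)"
    proof (rule differentiable_bound[OF convex_real_interval(5)[of a b]])
      fix t assume t: "t \<in> {a..b}"
      show "(\<delta> has_derivative (\<lambda>h. h *\<^sub>R \<delta>' t)) (at t within {a..b})"
        using deriv[OF t] by (simp add: has_vector_derivative_def)
      show "onorm (\<lambda>h. h *\<^sub>R \<delta>' t) \<le> K"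
        using K(2)[OF t] by (simp add: onorm_scaleR_left_lemma onorm_scaleR_left onorm_id)
    qed (use that in auto)
    then show ?thesis
      by simp
  qed
  with K show ?thesis
    using that[of K] by simp
qed

text \<open>The clamped parameter \<open>r\<close> lets the spliced curve be written as a sum of three absolutely
  continuous terms, each active on one of \<open>[0, a]\<close>, \<open>[a, b]\<close>, \<open>[b, 1]\<close>.\<close>

lemma timelike_splice:
  assumes tl: "timelike_fd UNIV mart_D mart_g mart_T \<gamma> \<gamma>'" and ab: "0 \<le> a" "a < b" "b \<le> 1"
    and \<delta>0: "\<delta> 0 = \<gamma> a" and \<delta>1: "\<delta> 1 = \<gamma> b + pt 0 0 c"
    and cont: "continuous_on {0..1} \<delta>'"
    and deriv: "\<And>t. t \<in> {0..1} \<Longrightarrow> (\<delta> has_vector_derivative \<delta>' t) (at t within {0..1}) \<and> \<delta>' t \<in> mart_D (\<delta> t)"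
    and pos: "\<And>t. 0 < t \<Longrightarrow> t < 1 \<Longrightarrow> \<delta>' t $ 1 > 0 \<and> \<delta>' t $ 2 > 0"
  shows "chron UNIV mart_D mart_g mart_T (\<gamma> 0) (\<gamma> 1 + pt 0 0 c)"
proof -
  obtain N where "negligible N" and N: "\<And>t. t \<in> {0..1} \<Longrightarrow> t \<notin> N \<Longrightarrow>
    (\<gamma> has_vector_derivative \<gamma>' t) (at t within {0..1}) \<and> \<gamma>' t \<in> mart_D (\<gamma> t) \<and> \<gamma>' t $ 1 > 0 \<and> \<gamma>' t $ 2 > 0"
    by (rule timelike_fdE[OF tl]) (rule that)
  have ac: "absolutely_continuous_on {0..1} \<gamma>"
    and meas: "\<gamma>' \<in> borel_measurable (lebesgue_on {0..1})"
    and int: "integrable (lebesgue_on {0..1}) (\<lambda>t. (norm (\<gamma>' t))\<^sup>2)"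
    using tl by (auto simp: timelike_fd_def horizontal_curve_def)
  \<comment> \<open>\<open>K\<close> is used twice: as Lipschitz constant for the absolute
    continuity of the new arc, and as bound on its velocity for square integrability.\<close>
  obtain K where "K \<ge> 0" and K: "\<And>t. t \<in> {0..1} \<Longrightarrow> norm (\<delta>' t) \<le> K"
    and lip: "\<And>x y. x \<in> {0..1} \<Longrightarrow> y \<in> {0..1} \<Longrightarrow> norm (\<delta> x - \<delta> y) \<le> K * \<bar>x - y\<bar>"
    by (rule lipschitz_if_continuous_derivative[OF cont]) (use deriv that in auto)
  define r where "r t = max 0 (min 1 ((t - a) / (b - a)))" for t
  have r01: "r t \<in> {0..1}" for t
    by (auto simp: r_def)
  have r_lip: "\<bar>r s - r t\<bar> \<le> \<bar>s - t\<bar> / (b - a)" for s t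
  proof -
    have "\<bar>r s - r t\<bar> \<le> \<bar>(s - a) / (b - a) - (t - a) / (b - a)\<bar>"
      unfolding r_def by (auto simp: max_def min_def abs_if)
    also have "\<dots> = \<bar>s - t\<bar> / (b - a)"
      using ab by (simp add: diff_divide_distrib[symmetric])
    finally show ?thesis .
  qed
  have r_le: "r t = 0" if "t \<le> a" for t
  proof -
    have "(t - a) / (b - a) \<le> 0"
      using that ab by (intro divide_nonpos_pos) auto
    then show ?thesis
      by (simp add: r_def)
  qed
  have r_ge: "r t = 1" if "b \<le> t" for t
  proof -
    have "(t - a) / (b - a) \<ge> 1"
      using that ab by simp
    then show ?thesis
      by (simp add: r_def)
  qed
  have r_mid: "r t = (t - a) / (b - a)" if "a \<le> t" "t \<le> b" for t
    using that ab by (simp add: r_def max_def min_def divide_le_eq_1)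
  define \<eta> where "\<eta> t = \<gamma> (min t a) + (\<delta> (r t) + (\<gamma> (max t b) + (- \<gamma> a - \<gamma> b)))" for t
  define \<eta>' where "\<eta>' t = (if t \<in> {a..b} then (1 / (b - a)) *\<^sub>R \<delta>' (r t) else \<gamma>' t)" for t
  have \<eta>_le: "\<eta> t = \<gamma> t" if "t \<le> a" for t
    using that ab by (simp add: \<eta>_def r_le \<delta>0 min_def max_def)
  have \<eta>_ge: "\<eta> t = \<gamma> t + pt 0 0 c" if "b \<le> t" for t
    using that ab by (simp add: \<eta>_def r_ge \<delta>1 min_def max_def)
  have \<eta>_mid: "\<eta> t = \<delta> ((t - a) / (b - a))" if "a \<le> t" "t \<le> b" for t
    using that ab by (simp add: \<eta>_def r_mid min_def max_def)
  have ac_\<eta>: "absolutely_continuous_on {0..1} \<eta>"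
    unfolding \<eta>_def
  proof (intro absolutely_continuous_on_add)
    show "absolutely_continuous_on {0..1} (\<lambda>t. \<gamma> (min t a))"
    proof (rule absolutely_continuous_on_reparam[OF ac])
      show "{min x a..min y a} \<subseteq> {0..1}" if "x \<le> y" "{x..y} \<subseteq> {0..1}" for x y :: real
        using that ab by auto
    qed auto
    show "absolutely_continuous_on {0..1} (\<lambda>t. \<gamma> (max t b))"
    proof (rule absolutely_continuous_on_reparam[OF ac])
      show "{max x b..max y b} \<subseteq> {0..1}" if "x \<le> y" "{x..y} \<subseteq> {0..1}" for x y :: real
        using that ab by auto
    qed auto
    show "absolutely_continuous_on {0..1} (\<lambda>t. \<delta> (r t))"
    proof (rule absolutely_continuous_on_lipschitz)
      fix s t :: real
      have "norm (\<delta> (r s) - \<delta> (r t)) \<le> K * \<bar>r s - r t\<bar>"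
        by (rule lip[OF r01 r01])
      also have "\<dots> \<le> K * (\<bar>s - t\<bar> / (b - a))"
        by (rule mult_left_mono[OF r_lip \<open>K \<ge> 0\<close>])
      finally show "norm (\<delta> (r s) - \<delta> (r t)) \<le> K / (b - a) * \<bar>s - t\<bar>"
        by simp
    qed
    show "absolutely_continuous_on {0..1} (\<lambda>t. - \<gamma> a - \<gamma> b)"
      by (rule absolutely_continuous_on_lipschitz[of _ _ 0]) simp
  qed
  have good: "(\<eta> has_vector_derivative \<eta>' t) (at t within {0..1}) \<and> \<eta>' t \<in> mart_D (\<eta> t) \<and> \<eta>' t $ 1 > 0 \<and> \<eta>' t $ 2 > 0"
    if t: "t \<in> {0..1}" "t \<notin> N \<union> {a, b}" for t
  proof -
    consider "t < a" | "b < t" | "a < t" "t < b"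
      using t by fastforce
    then show ?thesis
    proof cases
      case 1
      have "(\<eta> has_vector_derivative \<gamma>' t) (at t within {0..1})"
        by (rule has_vector_derivative_transform_within[of \<gamma> _ _ _ "a - t"])
          (use N[of t] t 1 in \<open>auto simp: dist_real_def \<eta>_le\<close>)
      then show ?thesis
        using N[of t] t 1 by (simp add: \<eta>'_def \<eta>_le)
    next
      case 2
      \<comment> \<open>The shifted tail has the same velocity and stays horizontal, since
        \<open>mart_D\<close> depends on the first two coordinates of the base point.\<close>
      have "((\<lambda>s. \<gamma> s + pt 0 0 c) has_vector_derivative \<gamma>' t) (at t within {0..1})"
        using N[of t] t by (auto intro!: derivative_eq_intros)
      then have "(\<eta> has_vector_derivative \<gamma>' t) (at t within {0..1})"
        by (rule has_vector_derivative_transform_within[of _ _ _ _ "t - b"])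
          (use t 2 in \<open>auto simp: dist_real_def \<eta>_ge\<close>)
      then show ?thesis
        using N[of t] t 2 by (simp add: \<eta>'_def \<eta>_ge mart_D_def)
    next
      case 3
      define \<tau> where "\<tau> = (t - a) / (b - a)"
      have \<tau>: "0 < \<tau>" "\<tau> < 1"
        using 3 by (auto simp: \<tau>_def)
      have "(\<delta> has_vector_derivative \<delta>' \<tau>) (at \<tau>)"
        using deriv[of \<tau>] \<tau> by (simp add: at_within_Icc_at)
      moreover have "((\<lambda>s. (s - a) / (b - a)) has_vector_derivative 1 / (b - a)) (at t)"
        unfolding has_real_derivative_iff_has_vector_derivative[symmetric]
        using ab by (auto intro!: derivative_eq_intros)
      ultimately have "(\<delta> \<circ> (\<lambda>s. (s - a) / (b - a)) has_vector_derivative (1 / (b - a)) *\<^sub>R \<delta>' \<tau>) (at t)"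
        unfolding \<tau>_def by (intro vector_diff_chain_at)
      then have "(\<eta> has_vector_derivative (1 / (b - a)) *\<^sub>R \<delta>' \<tau>) (at t)"
        by (rule has_vector_derivative_transform_within_open[of _ _ _ "{a<..<b}"])
          (use 3 in \<open>auto simp: \<eta>_mid\<close>)
      moreover have "r t = \<tau>" "\<eta> t = \<delta> \<tau>"
        using 3 by (auto simp: r_mid \<eta>_mid \<tau>_def)
      moreover have "(1 / (b - a)) *\<^sub>R \<delta>' \<tau> \<in> mart_D (\<delta> \<tau>)"
        using deriv[of \<tau>] \<tau> by (intro subspace_scale subspace_mart_D) auto
      ultimately show ?thesis
        using pos[OF \<tau>] 3 by (auto simp: \<eta>'_def intro: has_vector_derivative_at_within)
    qed
  qed
  have meas_\<eta>: "\<eta>' \<in> borel_measurable (lebesgue_on {0..1})"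
  proof -
    have "continuous_on {0..1} r"
      unfolding r_def using ab by (intro continuous_intros) auto
    then have "continuous_on {0..1} (\<lambda>t. (1 / (b - a)) *\<^sub>R \<delta>' (r t))"
      using r01 by (intro continuous_on_scaleR continuous_on_const continuous_on_compose2[OF cont]) auto
    then have "(\<lambda>t. (1 / (b - a)) *\<^sub>R \<delta>' (r t)) \<in> borel_measurable (lebesgue_on {0..1})"
      by (intro continuous_imp_measurable_on_sets_lebesgue) auto
    moreover have "{t \<in> space (lebesgue_on {0..1}). t \<in> {a..b}} \<in> sets (lebesgue_on {0..1})"
    proof -
      have "{t \<in> space (lebesgue_on {0..1}). t \<in> {a..b}} = {a..b}"
        using ab by auto
      then show ?thesis
        using ab by (simp add: sets_restrict_space_iff)
    qed
    ultimately show ?thesis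
      unfolding \<eta>'_def by (intro measurable_If meas)
  qed
  have int_\<eta>: "integrable (lebesgue_on {0..1}) (\<lambda>t. (norm (\<eta>' t))\<^sup>2)"
  proof (rule Bochner_Integration.integrable_bound)
    show "integrable (lebesgue_on {0..1}) (\<lambda>t. (norm (\<gamma>' t))\<^sup>2 + (K / (b - a))\<^sup>2)"
      using int by simp
    show "(\<lambda>t. (norm (\<eta>' t))\<^sup>2) \<in> borel_measurable (lebesgue_on {0..1})"
      using meas_\<eta> by measurable
    have "(norm (\<eta>' t))\<^sup>2 \<le> (norm (\<gamma>' t))\<^sup>2 + (K / (b - a))\<^sup>2" for t
    proof (cases "t \<in> {a..b}")
      case True
      have "norm (\<eta>' t) \<le> K / (b - a)"
        using True ab K[OF r01, of t] by (simp add: \<eta>'_def divide_right_mono)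
      then have "(norm (\<eta>' t))\<^sup>2 \<le> (K / (b - a))\<^sup>2"
        by (intro power_mono) auto
      then show ?thesis
        by (simp add: add_increasing)
    qed (auto simp: \<eta>'_def)
    then show "AE t in lebesgue_on {0..1}. norm ((norm (\<eta>' t))\<^sup>2) \<le> norm ((norm (\<gamma>' t))\<^sup>2 + (K / (b - a))\<^sup>2)"
      by simp
  qed
  have "negligible (N \<union> {a, b})"
    using \<open>negligible N\<close> by (simp add: negligible_Un)
  then have ae: "AE t in lebesgue_on {0..1}. (\<eta> has_vector_derivative \<eta>' t) (at t within {0..1}) \<and>
      \<eta>' t \<in> mart_D (\<eta> t) \<and> \<eta>' t $ 1 > 0 \<and> \<eta>' t $ 2 > 0"
    by (rule AE_lebesgue_on_I) (use good in auto)
  have "timelike_fd UNIV mart_D mart_g mart_T \<eta> \<eta>'"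
    unfolding timelike_fd_def horizontal_curve_def
  proof (intro conjI ac_\<eta> meas_\<eta> int_\<eta>)
    show "AE t in lebesgue_on {0..1}. (\<eta> has_vector_derivative \<eta>' t) (at t within {0..1}) \<and> \<eta>' t \<in> mart_D (\<eta> t)"
      using ae by eventually_elim auto
    show "AE t in lebesgue_on {0..1}. mart_g (\<eta> t) (\<eta>' t) (\<eta>' t) < 0 \<and> mart_g (\<eta> t) (mart_T (\<eta> t)) (\<eta>' t) < 0"
      using ae by eventually_elim (auto simp: mart_g_def mart_T_def)
  qed simp
  moreover have "\<eta> 0 = \<gamma> 0" "\<eta> 1 = \<gamma> 1 + pt 0 0 c"
    using ab by (simp_all add: \<eta>_le \<eta>_ge)
  ultimately show ?thesis
    unfolding chron_def by blast
qed

text \<open>Close to \<open>t0\<close> the curve has a short arc from \<open>a\<close> to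
  \<open>b\<close> with \<open>\<gamma> b $ 1 \<le> \<gamma> a $ 2\<close>. The height gain of this
  arc lies strictly between two bounds, so an arc gaining \<open>c\<close> more exists for every
  small \<open>c\<close> of either sign, and splicing carries \<open>c\<close> to the
  endpoint.\<close>

lemma chron_vertical_perturbation:
  assumes tl: "timelike_fd UNIV mart_D mart_g mart_T \<gamma> \<gamma>'" and t0: "0 \<le> t0" "t0 \<le> 1" "\<gamma> t0 $ 1 < \<gamma> t0 $ 2"
  shows "\<exists>r>0. \<forall>c. \<bar>c\<bar> < r \<longrightarrow> chron UNIV mart_D mart_g mart_T (\<gamma> 0) (\<gamma> 1 + pt 0 0 c)"
proof -
  \<comment> \<open>Half the gap: within distance \<open>e\<close> the first coordinate stays below
    the midpoint of the two values at \<open>t0\<close>, the second above it.\<close>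
  define e where "e = (\<gamma> t0 $ 2 - \<gamma> t0 $ 1) / 2"
  have "e > 0"
    using t0 by (simp add: e_def)
  have "continuous_on {0..1} \<gamma>"
    using tl by (intro absolutely_continuous_on_imp_continuous_on) (simp add: timelike_fd_def horizontal_curve_def)
  then obtain d where "d > 0" and d: "\<And>t. t \<in> {0..1} \<Longrightarrow> dist t t0 < d \<Longrightarrow> dist (\<gamma> t) (\<gamma> t0) < e"
    unfolding continuous_on_iff using t0 \<open>e > 0\<close> by (metis atLeastAtMost_iff)
  have close: "\<bar>\<gamma> t $ k - \<gamma> t0 $ k\<bar> < e" if "t \<in> {0..1}" "dist t t0 < d" for t k
    using d[OF that] component_le_norm_cart[of "\<gamma> t - \<gamma> t0" k] by (simp add: dist_norm)
  \<comment> \<open>Clamping to the unit interval admits \<open>t0 = 0\<close> and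
    \<open>t0 = 1\<close>, the two cases needed for the subbasis sets; the arc is then
    one-sided.\<close>
  define a where "a = max 0 (t0 - d / 2)"
  define b where "b = min 1 (t0 + d / 2)"
  have ab: "0 \<le> a" "a < b" "b \<le> 1" and "dist a t0 < d" "dist b t0 < d"
    using t0 \<open>d > 0\<close> by (auto simp: a_def b_def dist_real_def)
  then have "\<bar>\<gamma> a $ 2 - \<gamma> t0 $ 2\<bar> < e" "\<bar>\<gamma> b $ 1 - \<gamma> t0 $ 1\<bar> < e"
    by (auto intro!: close)
  then have "\<gamma> t0 $ 2 - e < \<gamma> a $ 2" "\<gamma> b $ 1 < \<gamma> t0 $ 1 + e"
    by (auto simp: abs_less_iff)
  moreover have "\<gamma> t0 $ 2 - e = \<gamma> t0 $ 1 + e"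
    by (simp add: e_def field_simps)
  ultimately have le: "\<gamma> b $ 1 \<le> \<gamma> a $ 2"
    by linarith
  note bounds = timelike_bounds[OF tl ab le]
  define L where "L = (\<gamma> a $ 2 - \<gamma> a $ 1) ^ 3 / 3 - (\<gamma> a $ 2 - \<gamma> b $ 1) ^ 3 / 3"
  define U where "U = (\<gamma> b $ 2 - \<gamma> a $ 1) ^ 3 / 3 - (\<gamma> b $ 2 - \<gamma> b $ 1) ^ 3 / 3"
  define r where "r = min (\<gamma> b $ 3 - \<gamma> a $ 3 - L) (U - (\<gamma> b $ 3 - \<gamma> a $ 3))"
  have "r > 0"
    using bounds by (simp add: r_def L_def U_def)
  have "chron UNIV mart_D mart_g mart_T (\<gamma> 0) (\<gamma> 1 + pt 0 0 c)" if cr: "\<bar>c\<bar> < r" for c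
  proof -
    obtain \<delta> \<delta>' where \<delta>: "\<delta> 0 = \<gamma> a" "\<delta> 1 = \<gamma> b + pt 0 0 c" "continuous_on {0..1} \<delta>'"
      "\<And>t. t \<in> {0..1} \<Longrightarrow> (\<delta> has_vector_derivative \<delta>' t) (at t within {0..1}) \<and> \<delta>' t \<in> mart_D (\<delta> t)"
      "\<And>t. 0 < t \<Longrightarrow> t < 1 \<Longrightarrow> \<delta>' t $ 1 > 0 \<and> \<delta>' t $ 2 > 0"
    proof (rule connecting_curve[of "\<gamma> a" "\<gamma> b + pt 0 0 c"])
      show "\<gamma> a $ 1 < (\<gamma> b + pt 0 0 c) $ 1" "\<gamma> a $ 2 < (\<gamma> b + pt 0 0 c) $ 2"
        using timelike_strict_mono[OF tl ab] by simp_all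
      have "c < r" "- r < c"
        using cr by auto
      then show "(\<gamma> a $ 2 - \<gamma> a $ 1) ^ 3 / 3 - (\<gamma> a $ 2 - (\<gamma> b + pt 0 0 c) $ 1) ^ 3 / 3 < (\<gamma> b + pt 0 0 c) $ 3 - \<gamma> a $ 3"
        and "(\<gamma> b + pt 0 0 c) $ 3 - \<gamma> a $ 3 < ((\<gamma> b + pt 0 0 c) $ 2 - \<gamma> a $ 1) ^ 3 / 3 - ((\<gamma> b + pt 0 0 c) $ 2 - (\<gamma> b + pt 0 0 c) $ 1) ^ 3 / 3"
        by (simp_all add: r_def L_def U_def)
    qed (use le in simp, rule that)
    show ?thesis
      by (rule timelike_splice[OF tl ab \<delta>])
  qed
  then show ?thesis
    using \<open>r > 0\<close> by blast
qed

text \<open>The distribution, the metric and \<open>mart_T\<close> do not involve the third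
  coordinate, so vertical translations preserve the whole structure.\<close>

lemma chron_translate:
  assumes "chron UNIV mart_D mart_g mart_T p q"
  shows "chron UNIV mart_D mart_g mart_T (p + pt 0 0 c) (q + pt 0 0 c)"
proof -
  obtain \<gamma> \<gamma>' where tl: "timelike_fd UNIV mart_D mart_g mart_T \<gamma> \<gamma>'" and pq: "\<gamma> 0 = p" "\<gamma> 1 = q"
    using assms by (auto simp: chron_def)
  have mart_D: "mart_D (\<gamma> t + pt 0 0 c) = mart_D (\<gamma> t)" for t
    by (simp add: mart_D_def)
  have g: "mart_g (\<gamma> t + pt 0 0 c) = mart_g (\<gamma> t)" "mart_T (\<gamma> t + pt 0 0 c) = mart_T (\<gamma> t)" for t
    by (simp_all add: fun_eq_iff mart_g_def mart_T_def)
  have ac: "absolutely_continuous_on {0..1} (\<lambda>t. \<gamma> t + pt 0 0 c)"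
    using tl by (intro absolutely_continuous_on_lipschitz_compose[of _ \<gamma> "\<lambda>x. x + pt 0 0 c" 1])
      (simp_all add: timelike_fd_def horizontal_curve_def)
  have "timelike_fd UNIV mart_D mart_g mart_T (\<lambda>t. \<gamma> t + pt 0 0 c) \<gamma>'"
    using tl ac by (simp add: timelike_fd_def horizontal_curve_def mart_D g has_vector_derivative_add_const)
  then show ?thesis
    unfolding chron_def using pq by (intro exI[of _ "\<lambda>t. \<gamma> t + pt 0 0 c"] exI[of _ \<gamma>']) simp
qed

section \<open>Comparison of the two topologies\<close>

text \<open>Containing all points slightly below \<open>pt 0 1 0\<close> passes to finite
  intersections and to unions, so it suffices to check it for subbasis sets containing that
  point.\<close>

lemma alexandrov_nbhd:
  assumes "openin (alexandrov_topology UNIV mart_D mart_g mart_T) S" "pt 0 1 0 \<in> S"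
  shows "\<exists>r>0. \<forall>c. 0 < c \<longrightarrow> c < r \<longrightarrow> pt 0 1 (- c) \<in> S"
proof -
  have "generate_topology_on (insert UNIV (range (I_fut UNIV mart_D mart_g mart_T) \<union> range (I_past UNIV mart_D mart_g mart_T))) S"
    using assms(1) by (simp add: alexandrov_topology_def openin_topology_generated_by)
  then show ?thesis
    using assms(2)
  proof induction
    case Empty
    then show ?case by simp
  next
    case (Int A B)
    then obtain r s where "r > 0" "s > 0" "\<And>c. 0 < c \<Longrightarrow> c < r \<Longrightarrow> pt 0 1 (- c) \<in> A"
      "\<And>c. 0 < c \<Longrightarrow> c < s \<Longrightarrow> pt 0 1 (- c) \<in> B"
      by auto
    then show ?case
      by (intro exI[of _ "min r s"]) auto
  next
    case (UN K)
    then obtain A where "A \<in> K" "pt 0 1 0 \<in> A"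
      by blast
    then show ?case
      using UN.IH by (meson UnionI)
  next
    case (Basis A)
    then consider "A = UNIV" | p where "A = I_fut UNIV mart_D mart_g mart_T p" | p where "A = I_past UNIV mart_D mart_g mart_T p"
      by blast
    then show ?case
    proof cases
      case 1
      then show ?thesis by (auto intro!: exI[of _ 1])
    next
      case 2
      then obtain \<gamma> \<gamma>' where tl: "timelike_fd UNIV mart_D mart_g mart_T \<gamma> \<gamma>'" and \<gamma>: "\<gamma> 0 = p" "\<gamma> 1 = pt 0 1 0"
        using Basis by (auto simp: I_fut_def chron_def)
      \<comment> \<open>The point is the end of the curve and has first coordinate 0 below second
        coordinate 1, so the perturbation applies at \<open>t0 = 1\<close>.\<close>
      obtain r where "r > 0" and r: "\<And>c. \<bar>c\<bar> < r \<Longrightarrow> chron UNIV mart_D mart_g mart_T p (pt 0 1 0 + pt 0 0 c)"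
        using chron_vertical_perturbation[OF tl, of 1] \<gamma> by auto
      have "pt 0 1 (- c) \<in> A" if "0 < c" "c < r" for c
        using r[of "- c"] that 2 by (simp add: I_fut_def pt_def)
      then show ?thesis
        using \<open>r > 0\<close> by blast
    next
      case 3
      then obtain \<gamma> \<gamma>' where tl: "timelike_fd UNIV mart_D mart_g mart_T \<gamma> \<gamma>'" and \<gamma>: "\<gamma> 0 = pt 0 1 0" "\<gamma> 1 = p"
        using Basis by (auto simp: I_past_def chron_def)
      \<comment> \<open>Now the point is the start of the curve. The end is raised by
        \<open>c\<close>, and translating everything down by \<open>c\<close> returns the end to
        \<open>p\<close> and lowers the start.\<close>
      obtain r where "r > 0" and r: "\<And>c. \<bar>c\<bar> < r \<Longrightarrow> chron UNIV mart_D mart_g mart_T (pt 0 1 0) (p + pt 0 0 c)"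
        using chron_vertical_perturbation[OF tl, of 0] \<gamma> by auto
      have "pt 0 1 (- c) \<in> A" if "0 < c" "c < r" for c
      proof -
        have "chron UNIV mart_D mart_g mart_T (pt 0 1 0 + pt 0 0 (- c)) (p + pt 0 0 c + pt 0 0 (- c))"
          using r[of c] that by (intro chron_translate) simp
        moreover have "p + pt 0 0 c + pt 0 0 (- c) = p" "pt 0 1 0 + pt 0 0 (- c) = pt 0 1 (- c)"
          by (simp_all add: pt_eq_iff)
        ultimately show ?thesis
          using 3 by (simp add: I_past_def)
      qed
      then show ?thesis
        using \<open>r > 0\<close> by blast
    qed
  qed
qed

section \<open>Time separation at \<open>pt 0 1 0\<close> and below it\<close>

lemma time_sep_lower:
  assumes "c > 0"
  shows "time_sep UNIV mart_D mart_g mart_T (pt (- 1) (- 1) 0) (pt 0 1 (- c)) = 0"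
proof -
  have "\<not> (nonspacelike_fd UNIV mart_D mart_g mart_T \<gamma> \<gamma>' \<and> \<gamma> 0 = pt (- 1) (- 1) 0 \<and> \<gamma> 1 = pt 0 1 (- c))" for \<gamma> \<gamma>'
    using nonspacelike_mono[of \<gamma> \<gamma>'] assms by auto
  then have "{(\<gamma>, \<gamma>'). nonspacelike_fd UNIV mart_D mart_g mart_T \<gamma> \<gamma>' \<and> \<gamma> 0 = pt (- 1) (- 1) 0 \<and> \<gamma> 1 = pt 0 1 (- c)} = {}"
    by blast
  then show ?thesis
    \<comment> \<open>With no admissible curve the supremum is taken over the empty set, which in
      \<open>ennreal\<close> is 0.\<close>
    unfolding time_sep_def by (simp only: image_empty Sup_empty bot_ennreal)
qed

lemma time_sep_gt:
  "ennreal (1 / 2) < time_sep UNIV mart_D mart_g mart_T (pt (- 1) (- 1) 0) (pt 0 1 0)"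
proof -
  \<comment> \<open>The \<open>min\<close> stops the first coordinate at 0 from time 1/2 on. Before,
    the curve runs on the diagonal, where horizontal vectors have no vertical part; afterwards the
    first coordinate is constant. Hence the height stays 0.\<close>
  define \<gamma> where "\<gamma> t = pt (min (2 * t - 1) 0) (2 * t - 1) 0" for t
  define \<gamma>' where "\<gamma>' t = pt (if t < 1 / 2 then 2 else 0) 2 0" for t :: real
  have good: "(\<gamma> has_vector_derivative \<gamma>' t) (at t within {0..1}) \<and> \<gamma>' t \<in> mart_D (\<gamma> t)"
    if "t \<notin> {1 / 2}" for t
  proof (cases "t < 1 / 2")
    case True
    have "((\<lambda>t. pt (2 * t - 1) (2 * t - 1) 0) has_vector_derivative pt 2 2 0) (at t)"
      unfolding pt_def by (auto intro!: derivative_eq_intros)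
    then have "(\<gamma> has_vector_derivative pt 2 2 0) (at t within {0..1})"
      by (rule has_vector_derivative_at_within[OF has_vector_derivative_transform_within_open[of _ _ _ "{..<1 / 2}"]])
        (use True in \<open>auto simp: \<gamma>_def\<close>)
    then show ?thesis
      using True by (simp add: \<gamma>'_def mart_D_def \<gamma>_def)
  next
    case False
    have "((\<lambda>t. pt 0 (2 * t - 1) 0) has_vector_derivative pt 0 2 0) (at t)"
      unfolding pt_def by (auto intro!: derivative_eq_intros)
    then have "(\<gamma> has_vector_derivative pt 0 2 0) (at t within {0..1})"
      by (rule has_vector_derivative_at_within[OF has_vector_derivative_transform_within_open[of _ _ _ "{1 / 2<..}"]])
        (use False that in \<open>auto simp: \<gamma>_def\<close>)
    then show ?thesis
      using False by (simp add: \<gamma>'_def mart_D_def)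
  qed
  have half: "{0..<1 / 2 :: real} \<in> sets (lebesgue_on {0..1})"
    by (auto simp: sets_restrict_space_iff)
  have "{t \<in> space (lebesgue_on {0..1}). t < 1 / 2} = {0..<1 / 2 :: real}"
    by auto
  then have S: "{t \<in> space (lebesgue_on {0..1}). t < 1 / 2} \<in> sets (lebesgue_on {0..1::real})"
    by (simp only: half)
  have "absolutely_continuous_on {0..1} \<gamma>"
  proof (rule absolutely_continuous_on_lipschitz)
    fix s t :: real
    have "\<bar>2 * s - 2 * t\<bar> = 2 * \<bar>s - t\<bar>"
      by (simp add: abs_if)
    moreover have "\<bar>min (2 * s - 1) 0 - min (2 * t - 1) 0\<bar> \<le> 2 * \<bar>s - t\<bar>"
      by (auto simp: min_def abs_if)
    moreover have "norm (pt x y 0) \<le> \<bar>x\<bar> + \<bar>y\<bar>" for x y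
      using norm_triangle_ineq[of "x *\<^sub>R axis 1 1" "y *\<^sub>R axis 2 1 :: real^3"] by (simp add: pt_def norm_axis_1)
    then have "norm (pt (min (2 * s - 1) 0 - min (2 * t - 1) 0) (2 * s - 2 * t) 0)
        \<le> \<bar>min (2 * s - 1) 0 - min (2 * t - 1) 0\<bar> + \<bar>2 * s - 2 * t\<bar>"
      by blast
    moreover have "\<gamma> s - \<gamma> t = pt (min (2 * s - 1) 0 - min (2 * t - 1) 0) (2 * s - 2 * t) 0"
      by (simp add: \<gamma>_def pt_eq_iff)
    ultimately show "norm (\<gamma> s - \<gamma> t) \<le> 4 * \<bar>s - t\<bar>"
      by simp
  qed
  moreover have "\<gamma>' \<in> borel_measurable (lebesgue_on {0..1})"
    unfolding \<gamma>'_def if_distrib[of "\<lambda>x. pt x 2 0"] by (intro measurable_If S measurable_const) simp_all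
  moreover have "integrable (lebesgue_on {0..1}) (\<lambda>t. (norm (\<gamma>' t))\<^sup>2)"
  proof (rule Bochner_Integration.integrable_bound)
    show "integrable (lebesgue_on {0..1::real}) (\<lambda>t. (norm (pt 2 2 0))\<^sup>2 + (norm (pt 0 2 0))\<^sup>2)"
      by simp
    show "(\<lambda>t. (norm (\<gamma>' t))\<^sup>2) \<in> borel_measurable (lebesgue_on {0..1})"
      using \<open>\<gamma>' \<in> borel_measurable (lebesgue_on {0..1})\<close> by measurable
  qed (auto simp: \<gamma>'_def)
  moreover have "AE t in lebesgue_on {0..1}. (\<gamma> has_vector_derivative \<gamma>' t) (at t within {0..1}) \<and> \<gamma>' t \<in> mart_D (\<gamma> t)"
    by (rule AE_lebesgue_on_I[of "{1 / 2}"]) (use good in auto)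
  moreover have "mart_g p (\<gamma>' t) (\<gamma>' t) \<le> 0 \<and> \<gamma>' t \<noteq> 0 \<and> mart_g p (mart_T p) (\<gamma>' t) < 0" for p t
    by (auto simp: \<gamma>'_def mart_g_def mart_T_def pt_eq_iff)
  ultimately have "nonspacelike_fd UNIV mart_D mart_g mart_T \<gamma> \<gamma>'"
    by (simp add: nonspacelike_fd_def horizontal_curve_def)
  moreover have "\<gamma> 0 = pt (- 1) (- 1) 0" "\<gamma> 1 = pt 0 1 0"
    by (simp_all add: \<gamma>_def)
  ultimately have "(\<integral>\<^sup>+ t. ennreal (sqrt (- mart_g (\<gamma> t) (\<gamma>' t) (\<gamma>' t))) \<partial>lebesgue_on {0..1})
      \<le> time_sep UNIV mart_D mart_g mart_T (pt (- 1) (- 1) 0) (pt 0 1 0)"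
    unfolding time_sep_def by (intro SUP_upper2[of "(\<gamma>, \<gamma>')"]) auto
  moreover have "ennreal 1 \<le> (\<integral>\<^sup>+ t. ennreal (sqrt (- mart_g (\<gamma> t) (\<gamma>' t) (\<gamma>' t))) \<partial>lebesgue_on {0..1})"
  proof -
    \<comment> \<open>The length comes from the diagonal half, run at constant speed
      \<open>sqrt 8\<close>. Bounding this below by 2 on an interval of length 1/2 gives length at
      least 1, above the radius 1/2.\<close>
    have "emeasure (lebesgue_on {0..1}) {0..<1 / 2 :: real} = ennreal (1 / 2)"
      by (subst emeasure_restrict_space) auto
    moreover have "ennreal 1 = ennreal 2 * ennreal (1 / 2)"
      by (subst ennreal_mult[symmetric]) auto
    ultimately have "ennreal 1 = ennreal 2 * emeasure (lebesgue_on {0..1}) {0..<1 / 2 :: real}"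
      by (simp only:)
    also have "\<dots> = (\<integral>\<^sup>+ t. ennreal 2 * indicator {0..<1 / 2} t \<partial>lebesgue_on {0..1::real})"
      by (rule nn_integral_cmult_indicator[OF half, symmetric])
    also have "\<dots> \<le> (\<integral>\<^sup>+ t. ennreal (sqrt (- mart_g (\<gamma> t) (\<gamma>' t) (\<gamma>' t))) \<partial>lebesgue_on {0..1})"
    proof (rule nn_integral_mono)
      fix t :: real
      have "2 \<le> sqrt 8"
        by (rule real_le_rsqrt) simp
      then have "ennreal 2 \<le> ennreal (sqrt 8)"
        by (rule ennreal_leI)
      then show "ennreal 2 * indicator {0..<1 / 2} t \<le> ennreal (sqrt (- mart_g (\<gamma> t) (\<gamma>' t) (\<gamma>' t)))"
        by (auto simp: indicator_def \<gamma>'_def mart_g_def)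
    qed
    finally show ?thesis .
  qed
  moreover have "ennreal (1 / 2) < ennreal 1"
    by (rule ennreal_lessI) auto
  ultimately show ?thesis
    by (meson less_le_trans)
qed

theorem theorem4p4:
  shows "\<exists>(M :: (real^3) set) D g T k. sub_space_time M D g T k \<and>
           tsep_topology M D g T \<noteq> alexandrov_topology M D g T"
proof (intro exI conjI)
  show "sub_space_time UNIV mart_D mart_g mart_T 2"
    by (rule sub_space_time_mart)
  let ?O = "O_fut UNIV mart_D mart_g mart_T (pt (- 1) (- 1) 0) (1 / 2)"
  show "tsep_topology UNIV mart_D mart_g mart_T \<noteq> alexandrov_topology UNIV mart_D mart_g mart_T"
  proof
    assume eq: "tsep_topology UNIV mart_D mart_g mart_T = alexandrov_topology UNIV mart_D mart_g mart_T"
    have "openin (tsep_topology UNIV mart_D mart_g mart_T) ?O"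
      unfolding tsep_topology_def
      by (rule topology_generated_by_Basis) (auto intro!: exI[of _ "pt (- 1) (- 1) 0"] exI[of _ "1 / 2"])
    then have "openin (alexandrov_topology UNIV mart_D mart_g mart_T) ?O"
      by (simp add: eq)
    moreover have "pt 0 1 0 \<in> ?O"
      using time_sep_gt by (simp add: O_fut_def)
    ultimately obtain r where "r > 0" "\<And>c. 0 < c \<Longrightarrow> c < r \<Longrightarrow> pt 0 1 (- c) \<in> ?O"
      using alexandrov_nbhd by blast
    \<comment> \<open>Any height in the open range does; at a point strictly below
      \<open>pt 0 1 0\<close> the time separation is 0, not more than 1/2.\<close>
    then have "pt 0 1 (- (r / 2)) \<in> ?O"
      by simp
    then show False
      using time_sep_lower[of "r / 2"] \<open>r > 0\<close> by (simp add: O_fut_def)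
  qed
qed

end
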